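(* For each $n\in\mathbb{N}$, let $(\mathbb{X},T,S)=(\mathbb{X}_n,T_n,S_n)$ be a Markov triple, i.e. $\mathbb{X}$ is a finite set, $T$ is an irreducible stochastic matrix on $\mathbb{X}$, and $S\subseteq\mathbb{X}$ is a non-empty subset (the dependence on $n$ is kept implicit in the notation). Assume that, for every $n$: (i) (non-negative curvature) $\Gamma(P_tf)(x)\le P_t(\Gamma f)(x)$ for all $t\ge 0$, all $f\colon\mathbb{X}\to\mathbb{R}$ and all $x\in\mathbb{X}$; (ii) (symmetric support) for all $x,y\in\mathbb{X}$, $T(x,y)>0$ implies $T(y,x)>0$. Assume moreover that for some $\varepsilon\in(0,1)$, $$\frac{\mathrm{t}_{\mathrm{mix}}^{(S)}(\varepsilon)}{\mathrm{t}_{\mathrm{mls}}\,\log\log d}\xrightarrow[n\to\infty]{}+\infty .$$ Then, for all $\varepsilon\in(0,1)$, $$\frac{\mathrm{t}_{\mathrm{mix}}^{(S)}(1-\varepsilon)}{\mathrm{t}_{\mathrm{mix}}^{(S)}(\varepsilon)}\xrightarrow[n\to\infty]{}1 .$$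
   Context: Given a finite set $\mathbb{X}$ and an irreducible stochastic matrix $T$ on $\mathbb{X}$, consider the continuous-time Markov chain $(X_t)_{t\ge 0}$ on $\mathbb{X}$ with generator $(Lf)(x)=\sum_{y\in\mathbb{X}}T(x,y)(f(y)-f(x))$ for $f\colon\mathbb{X}\to\mathbb{R}$, and semi-group $P_t=e^{tL}$. Let $\pi$ be its unique stationary distribution. The carré du champ operator is $$(\Gamma f)(x)=\frac12\sum_{y\in\mathbb{X}}T(x,y)(f(y)-f(x))^2 .$$ Write $x\sim y$ if $T(x,y)>0$. The degree of the chain is $d:=\max_{x\sim y}\frac{1}{T(x,y)}$, the inverse of the minimum non-zero transition probability. For an $\mathbb{X}$-valued random variable $X$ with density $f$ with respect to $\pi$ (i.e. $f(x)=\mathbb{P}(X=x)/\pi(x)$), set $\mathrm{TV}(X)=\sup_{A\subseteq\mathbb{X}}|\mathbb{P}(X\in A)-\pi(A)|$ and $\mathrm{Ent}(X)=\mathbb{E}[\log f(X)]$. The inverse modified log-Sobolev constant $\mathrm{t}_{\mathrm{mls}}$ is the smallest number such that $\mathrm{Ent}(X_t)\le \mathrm{Ent}(X_0)\exp(-t/\mathrm{t}_{\mathrm{mls}})$ for all $t\ge 0$ and every initial law of $X_0$. For $o\in\mathbb{X}$ and $\varepsilon\in(0,1)$, $\mathrm{t}_{\mathrm{mix}}^{(o)}(\varepsilon)=\min\{t\ge 0\colon \mathrm{TV}(X_t)\le\varepsilon\}$, where $(X_t)_{t\ge0}$ is the chain started from $X_0=o$; and $\mathrm{t}_{\mathrm{mix}}^{(S)}(\varepsilon)=\max_{o\in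 S}\mathrm{t}_{\mathrm{mix}}^{(o)}(\varepsilon)$. The quantities $\mathrm{t}_{\mathrm{mix}}^{(S)}$, $\mathrm{t}_{\mathrm{mls}}$, $d$ are those of the $n$-th triple.
   Formalization: In the assumption, log log d is replaced by max(1, log log d); with the bare log log d the claim fails for chains whose degree tends to e from above (biased walks on cycles), while for d bounded away from e from above (e.g. d ≥ 3) the two assumptions are equivalent. *)

theory Defs
  imports Complex_Main
begin

text \<open>
  Matrices, functions and laws on a finite set \<open>X :: 'a set\<close> are functions on the whole type
  \<open>'a\<close>. For arguments in \<open>X\<close> every notion below depends only on their values on \<open>X\<close>.
\<close>

definition stochastic_on :: "'a set \<Rightarrow> ('a \<Rightarrow> 'a \<Rightarrow> real) \<Rightarrow> bool" where
  "stochastic_on X T \<longleftrightarrow> (\<forall>x\<in>X. (\<forall>y\<in>X. 0 \<le> T x y) \<and> (\<Sum>y\<in>X. T x y) = 1)"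

primrec mat_pow_on :: "'a set \<Rightarrow> ('a \<Rightarrow> 'a \<Rightarrow> real) \<Rightarrow> nat \<Rightarrow> 'a \<Rightarrow> 'a \<Rightarrow> real" where
  "mat_pow_on X T 0 = (\<lambda>x y. of_bool (x = y))"
| "mat_pow_on X T (Suc k) = (\<lambda>x y. \<Sum>z\<in>X. T x z * mat_pow_on X T k z y)"

definition irreducible_on :: "'a set \<Rightarrow> ('a \<Rightarrow> 'a \<Rightarrow> real) \<Rightarrow> bool" where
  "irreducible_on X T \<longleftrightarrow> (\<forall>x\<in>X. \<forall>y\<in>X. \<exists>k. mat_pow_on X T k x y > 0)"

definition markov_triple :: "'a set \<Rightarrow> ('a \<Rightarrow> 'a \<Rightarrow> real) \<Rightarrow> 'a set \<Rightarrow> bool" where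
  "markov_triple X T S \<longleftrightarrow>
     finite X \<and> stochastic_on X T \<and> irreducible_on X T \<and> S \<subseteq> X \<and> S \<noteq> {}"

definition generator :: "'a set \<Rightarrow> ('a \<Rightarrow> 'a \<Rightarrow> real) \<Rightarrow> ('a \<Rightarrow> real) \<Rightarrow> 'a \<Rightarrow> real" where
  "generator X T f = (\<lambda>x. \<Sum>y\<in>X. T x y * (f y - f x))"

text \<open>The exponential series of \<open>t L\<close>, applied to \<open>f\<close> and evaluated at \<open>x\<close>.\<close>

definition heat_semigroup ::
    "'a set \<Rightarrow> ('a \<Rightarrow> 'a \<Rightarrow> real) \<Rightarrow> real \<Rightarrow> ('a \<Rightarrow> real) \<Rightarrow> 'a \<Rightarrow> real" where
  "heat_semigroup X T t f = (\<lambda>x. \<Sum>k. t ^ k / fact k * (generator X T ^^ k) f x)"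

definition carre_du_champ :: "'a set \<Rightarrow> ('a \<Rightarrow> 'a \<Rightarrow> real) \<Rightarrow> ('a \<Rightarrow> real) \<Rightarrow> 'a \<Rightarrow> real" where
  "carre_du_champ X T f = (\<lambda>x. 1 / 2 * (\<Sum>y\<in>X. T x y * (f y - f x)\<^sup>2))"

text \<open>Laws vanish outside \<open>X\<close>, so that a law is determined by its values on \<open>X\<close>.\<close>

definition law_on :: "'a set \<Rightarrow> ('a \<Rightarrow> real) \<Rightarrow> bool" where
  "law_on X \<mu> \<longleftrightarrow> (\<forall>x\<in>X. 0 \<le> \<mu> x) \<and> (\<forall>x. x \<notin> X \<longrightarrow> \<mu> x = 0) \<and> (\<Sum>x\<in>X. \<mu> x) = 1"

text \<open>
  The law of \<open>X\<^sub>t\<close> when \<open>X\<^sub>0\<close> has law \<open>\<mu>\<close>: the probability of \<open>X\<^sub>t = y\<close> is the \<open>\<mu>\<close>-average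
  of \<open>P\<^sub>t 1\<^sub>y\<close>.
\<close>

definition law_at ::
    "'a set \<Rightarrow> ('a \<Rightarrow> 'a \<Rightarrow> real) \<Rightarrow> ('a \<Rightarrow> real) \<Rightarrow> real \<Rightarrow> 'a \<Rightarrow> real" where
  "law_at X T \<mu> t = (\<lambda>y. \<Sum>x\<in>X. \<mu> x * heat_semigroup X T t (\<lambda>z. of_bool (z = y)) x)"

definition stationary_law :: "'a set \<Rightarrow> ('a \<Rightarrow> 'a \<Rightarrow> real) \<Rightarrow> 'a \<Rightarrow> real" where
  "stationary_law X T = (THE p. law_on X p \<and> (\<forall>t\<ge>0. law_at X T p t = p))"

text \<open>Total variation distance and relative entropy of a law \<open>\<mu>\<close> with respect to the stationary law.\<close>

definition TV :: "'a set \<Rightarrow> ('a \<Rightarrow> 'a \<Rightarrow> real) \<Rightarrow> ('a \<Rightarrow> real) \<Rightarrow> real" where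
  "TV X T \<mu> = (SUP A\<in>Pow X. \<bar>(\<Sum>x\<in>A. \<mu> x) - (\<Sum>x\<in>A. stationary_law X T x)\<bar>)"

definition Ent :: "'a set \<Rightarrow> ('a \<Rightarrow> 'a \<Rightarrow> real) \<Rightarrow> ('a \<Rightarrow> real) \<Rightarrow> real" where
  "Ent X T \<mu> = (\<Sum>x\<in>X. \<mu> x * ln (\<mu> x / stationary_law X T x))"

text \<open>
  The constraint \<open>c > 0\<close> matters, since \<open>t / 0 = 0\<close> would make \<open>c = 0\<close> always admissible.
  The infimum is a minimum, except when \<open>X\<close> is a singleton, where it is \<open>0\<close>.
\<close>

definition t_mls :: "'a set \<Rightarrow> ('a \<Rightarrow> 'a \<Rightarrow> real) \<Rightarrow> real" where
  "t_mls X T = Inf {c. c > 0 \<and> (\<forall>\<mu>. law_on X \<mu> \<longrightarrow>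
     (\<forall>t\<ge>0. Ent X T (law_at X T \<mu> t) \<le> Ent X T \<mu> * exp (- t / c)))}"

definition t_mix_from :: "'a set \<Rightarrow> ('a \<Rightarrow> 'a \<Rightarrow> real) \<Rightarrow> 'a \<Rightarrow> real \<Rightarrow> real" where
  "t_mix_from X T o' \<epsilon> =
     (LEAST t. t \<ge> 0 \<and> TV X T (law_at X T (\<lambda>x. of_bool (x = o')) t) \<le> \<epsilon>)"

definition t_mix :: "'a set \<Rightarrow> ('a \<Rightarrow> 'a \<Rightarrow> real) \<Rightarrow> 'a set \<Rightarrow> real \<Rightarrow> real" where
  "t_mix X T S \<epsilon> = Max ((\<lambda>x. t_mix_from X T x \<epsilon>) ` S)"

definition chain_degree :: "'a set \<Rightarrow> ('a \<Rightarrow> 'a \<Rightarrow> real) \<Rightarrow> real" where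
  "chain_degree X T = Max {1 / T x y | x y. x \<in> X \<and> y \<in> X \<and> T x y > 0}"

text \<open>
  The factor \<open>log log d\<close> of the cutoff criterion is read as \<open>max 1 (ln (ln d))\<close>, with
  \<open>d = chain_degree X T\<close>. Untruncated it is negative for \<open>d < e\<close> and tends to \<open>0\<close> as \<open>d\<close>
  decreases to \<open>e\<close>, so that the criterion could hold merely because its denominator degenerates:
  the walk on the cycle of length \<open>n\<close> that steps back with probability \<open>1 / d\<^sub>n\<close> and forward
  otherwise has no cutoff, but meets the untruncated criterion if \<open>d\<^sub>n > e\<close> tends to \<open>e\<close>.
\<close>

definition nonneg_curved :: "'a set \<Rightarrow> ('a \<Rightarrow> 'a \<Rightarrow> real) \<Rightarrow> bool" where
  "nonneg_curved X T \<longleftrightarrow>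
     (\<forall>t\<ge>0. \<forall>f. \<forall>x\<in>X. carre_du_champ X T (heat_semigroup X T t f) x
                      \<le> heat_semigroup X T t (carre_du_champ X T f) x)"

definition symmetric_support :: "'a set \<Rightarrow> ('a \<Rightarrow> 'a \<Rightarrow> real) \<Rightarrow> bool" where
  "symmetric_support X T \<longleftrightarrow> (\<forall>x\<in>X. \<forall>y\<in>X. T x y > 0 \<longrightarrow> T y x > 0)"

end

theory Submission
  imports Defs "HOL-Analysis.Analysis"
begin

text \<open>
  Cutoff follows from a bound on the width of the mixing window: for every \<open>\<delta> > 0\<close> there is a constant
  \<open>C\<close>, depending on \<open>\<epsilon>\<close> and \<open>\<delta>\<close> only, such that
  \<open>t_mix \<epsilon> \<le> (1 + \<delta>) t_mix (1 - \<epsilon>) + C t_mls max 1 (ln (ln d))\<close>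
  (\<open>t_mix_window\<close>). Under the hypothesis of the theorem the second term is negligible.

  Fix a starting state and let \<open>E\<close>, \<open>I = - E'\<close> and \<open>V\<close> be the entropy of \<open>X\<^sub>t\<close>, its dissipation, and the
  variance under the law of \<open>X\<^sub>t\<close> of the log-density \<open>g\<close> of \<open>X\<^sub>t\<close>. Once the distance to equilibrium is at
  most \<open>1 - \<epsilon>\<close>, Chebyshev's inequality gives \<open>E\<^sup>2 = O(1 + V)\<close> (\<open>reverse_pinsker\<close>). Non-negative
  curvature gives \<open>V \<le> 2 t P\<^sub>t (\<Gamma> g)\<close> at the starting state (\<open>local_poincare\<close>). For diffusions the chain
  rule would identify \<open>P\<^sub>t (\<Gamma> g)\<close> with \<open>I\<close>. On a discrete space it survives with an extra factor, the
  size of the downward jumps of \<open>g\<close> (\<open>sq_le_Phi\<close>). These jumps are \<open>O(1 + ln d)\<close>, except near states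
  that are only reached by an unusually large number of jumps; the exceptional states are controlled by
  the variance of a Poisson variable and contribute \<open>O((1 + ln d)\<^sup>2 / t)\<close> to \<open>P\<^sub>t (\<Gamma> g)\<close>
  (\<open>approximate_chain_rule\<close>).

  With \<open>D = 1 + ln d\<close> all this amounts to \<open>E\<^sup>2 = O(t D (- E') + D\<^sup>2)\<close>. Such a differential inequality
  brings \<open>E\<close> down to \<open>O(D)\<close> within a time \<open>\<delta> t\<close>, from any initial value (\<open>riccati_decay\<close>). The modified
  log-Sobolev inequality then makes \<open>E\<close> small after a further time of order
  \<open>t_mls (1 + ln D)\<close>, and Pinsker's inequality concludes.
\<close>

section \<open>Exponential generating functions\<close>

text \<open>
  The heat flow is handled through series of the form \<open>\<Sum>k. t\<^sup>k / k! * u\<^sub>k\<close>, with \<open>u\<close> a matrix entry of \<open>T\<^sup>k\<close> or a value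
  of \<open>L\<^sup>k f\<close>. The parameter \<open>b\<close> in the growth bound \<open>\<bar>u\<^sub>k\<bar> \<le> B b\<^sup>k\<close> is \<open>1\<close> for stochastic matrices and
  \<open>2\<close> for the generator and for sequences with an additional factor \<open>k\<close>.
\<close>

definition egf :: "(nat \<Rightarrow> real) \<Rightarrow> real \<Rightarrow> real" where
  "egf u t = (\<Sum>k. t ^ k / fact k * u k)"

lemma summable_egf:
  fixes u :: "nat \<Rightarrow> real"
  assumes "\<And>k. \<bar>u k\<bar> \<le> B * b ^ k"
  shows "summable (\<lambda>k. t ^ k / fact k * u k)"
proof (rule summable_comparison_test')
  show "summable (\<lambda>k. B * (inverse (fact k) * (\<bar>t\<bar> * b) ^ k))"
    by (intro summable_mult summable_exp)
  show "norm (t ^ k / fact k * u k) \<le> B * (inverse (fact k) * (\<bar>t\<bar> * b) ^ k)" if "k \<ge> 0" for k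
  proof -
    have "norm (t ^ k / fact k * u k) = \<bar>t\<bar> ^ k / fact k * \<bar>u k\<bar>"
      by (simp add: abs_mult power_abs)
    also have "\<dots> \<le> \<bar>t\<bar> ^ k / fact k * (B * b ^ k)"
      by (intro mult_left_mono assms) auto
    finally show ?thesis by (simp add: field_simps power_mult_distrib)
  qed
qed

lemma egf_0 [simp]: "egf u 0 = u 0"
proof -
  have "egf u 0 = (\<Sum>k. (u k / fact k) * 0 ^ k)"
    unfolding egf_def by (simp add: mult.commute)
  also have "\<dots> = u 0" by (subst powser_zero) simp
  finally show ?thesis .
qed

text \<open>
  Differentiating in \<open>t\<close> shifts the sequence: this turns recursions in \<open>k\<close> into differential
  equations.
\<close>

lemma has_derivative_egf:
  assumes "\<And>k. \<bar>u k\<bar> \<le> B * b ^ k"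
  shows "(egf u has_real_derivative egf (\<lambda>k. u (Suc k)) t) (at t)"
proof -
  define c where "c k = u k / fact k" for k
  have "summable (\<lambda>k. c k * y ^ k)" for y
    using summable_egf[of u B b y, OF assms] by (simp add: c_def field_simps)
  then have "((\<lambda>t. \<Sum>k. c k * t ^ k) has_real_derivative (\<Sum>k. diffs c k * t ^ k)) (at t)"
    by (rule termdiffs_strong_converges_everywhere)
  moreover have "diffs c k * t ^ k = t ^ k / fact k * u (Suc k)" for k
    by (simp add: diffs_def c_def field_simps del: of_nat_Suc)
  moreover have "(\<lambda>t. \<Sum>k. c k * t ^ k) = egf u"
    by (simp add: c_def egf_def fun_eq_iff mult.commute)
  ultimately show ?thesis by (simp add: egf_def)
qed

lemma egf_const_1: "egf (\<lambda>k. 1) t = exp t"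
  by (simp add: egf_def exp_def divide_inverse_commute)

lemma egf_sum:
  assumes "\<And>i k. i \<in> I \<Longrightarrow> \<bar>u i k\<bar> \<le> B i * b ^ k"
  shows "egf (\<lambda>k. \<Sum>i\<in>I. c i * u i k) t = (\<Sum>i\<in>I. c i * egf (u i) t)"
proof -
  have "(\<Sum>i\<in>I. c i * egf (u i) t) = (\<Sum>i\<in>I. \<Sum>k. t ^ k / fact k * (c i * u i k))"
    unfolding egf_def
    by (intro sum.cong refl, subst suminf_mult [OF summable_egf, symmetric])
      (use assms in \<open>auto simp: mult_ac\<close>)
  also have "\<dots> = (\<Sum>k. \<Sum>i\<in>I. t ^ k / fact k * (c i * u i k))"
  proof (rule suminf_sum [symmetric])
    fix i assume i: "i \<in> I"
    have "\<bar>c i * u i k\<bar> \<le> (\<bar>c i\<bar> * B i) * b ^ k" for k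
      using mult_left_mono[OF assms[OF i, of k], of "\<bar>c i\<bar>"] by (simp add: abs_mult mult_ac)
    then show "summable (\<lambda>k. t ^ k / fact k * (c i * u i k))" by (rule summable_egf)
  qed
  also have "\<dots> = egf (\<lambda>k. \<Sum>i\<in>I. c i * u i k) t"
    by (simp add: egf_def sum_distrib_left)
  finally show ?thesis by simp
qed

section \<open>The heat kernel\<close>

lemma sum_point_mass:
  fixes h :: "'a \<Rightarrow> real"
  assumes "finite A" "x \<in> A"
  shows "(\<Sum>z\<in>A. of_bool (x = z) * h z) = h x" "(\<Sum>z\<in>A. of_bool (z = x) * h z) = h x"
    "(\<Sum>z\<in>A. h z * of_bool (x = z)) = h x" "(\<Sum>z\<in>A. h z * of_bool (z = x)) = h x"
  using assms by (auto simp: sum.remove[of A x] intro!: sum.neutral)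

locale finite_chain =
  fixes X :: "'a set" and T :: "'a \<Rightarrow> 'a \<Rightarrow> real"
  assumes finite_X: "finite X" and X_ne: "X \<noteq> {}"
    and stochastic: "stochastic_on X T" and irreducible: "irreducible_on X T"
begin

abbreviation "pow \<equiv> mat_pow_on X T"

text \<open>
  The generator is \<open>T - I\<close>, so \<open>e\<^sup>t\<^sup>L\<close> is also the mixture of the powers of \<open>T\<close> over a Poisson number
  of jumps with mean \<open>t\<close>. Unlike the exponential series of \<open>t L\<close>, this one has non-negative terms.
\<close>

definition kernel :: "real \<Rightarrow> 'a \<Rightarrow> 'a \<Rightarrow> real" where
  "kernel t x y = exp (- t) * egf (\<lambda>k. pow k x y) t"

lemma T_nonneg: "x \<in> X \<Longrightarrow> y \<in> X \<Longrightarrow> 0 \<le> T x y"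
  and T_sum: "x \<in> X \<Longrightarrow> (\<Sum>y\<in>X. T x y) = 1"
  using stochastic by (auto simp: stochastic_on_def)

lemma T_le_1: "x \<in> X \<Longrightarrow> y \<in> X \<Longrightarrow> T x y \<le> 1"
  using member_le_sum[of y X "T x"] T_nonneg T_sum finite_X by auto

lemma pow_nonneg: "x \<in> X \<Longrightarrow> y \<in> X \<Longrightarrow> 0 \<le> pow k x y"
  by (induction k arbitrary: x) (auto intro!: sum_nonneg mult_nonneg_nonneg T_nonneg)

lemma pow_sum: "x \<in> X \<Longrightarrow> (\<Sum>y\<in>X. pow k x y) = 1"
proof (induction k arbitrary: x)
  case 0
  then show ?case using finite_X by (simp add: of_bool_def)
next
  case (Suc k)
  have "(\<Sum>y\<in>X. pow (Suc k) x y) = (\<Sum>z\<in>X. T x z * (\<Sum>y\<in>X. pow k z y))"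
    unfolding mat_pow_on.simps sum_distrib_left by (rule sum.swap)
  then show ?case using Suc T_sum by simp
qed

lemma pow_le_1: "x \<in> X \<Longrightarrow> y \<in> X \<Longrightarrow> pow k x y \<le> 1"
  using member_le_sum[of y X "pow k x"] pow_nonneg pow_sum finite_X by auto

lemma pow_bound: "x \<in> X \<Longrightarrow> y \<in> X \<Longrightarrow> \<bar>pow k x y\<bar> \<le> 1 * 1 ^ k"
  using pow_nonneg pow_le_1 by auto

lemma pow_Suc_right: "x \<in> X \<Longrightarrow> y \<in> X \<Longrightarrow> pow (Suc k) x y = (\<Sum>z\<in>X. pow k x z * T z y)"
proof (induction k arbitrary: x)
  case 0
  then show ?case using finite_X by (simp add: sum_point_mass)
next
  case (Suc k)
  have "pow (Suc (Suc k)) x y = (\<Sum>w\<in>X. T x w * (\<Sum>z\<in>X. pow k w z * T z y))"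
    by (subst mat_pow_on.simps, intro sum.cong refl arg_cong2[of _ _ _ _ "(*)"]) (use Suc in auto)
  also have "\<dots> = (\<Sum>z\<in>X. (\<Sum>w\<in>X. T x w * pow k w z) * T z y)"
    unfolding sum_distrib_left sum_distrib_right mult.assoc by (rule sum.swap)
  finally show ?case by simp
qed

lemma kernel_backward:
  assumes "x \<in> X" "y \<in> X"
  shows "((\<lambda>t. kernel t x y) has_real_derivative (\<Sum>z\<in>X. T x z * kernel t z y) - kernel t x y) (at t)"
proof -
  have "egf (\<lambda>k. pow (Suc k) x y) t = (\<Sum>z\<in>X. T x z * egf (\<lambda>k. pow k z y) t)"
    unfolding mat_pow_on.simps by (rule egf_sum[where b = 1]) (rule pow_bound[OF _ assms(2)])
  then have "((\<lambda>t. kernel t x y) has_real_derivative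
      exp (- t) * (\<Sum>z\<in>X. T x z * egf (\<lambda>k. pow k z y) t) - exp (- t) * egf (\<lambda>k. pow k x y) t) (at t)"
    unfolding kernel_def
    by (auto intro!: derivative_eq_intros has_derivative_egf[OF pow_bound] assms simp del: mat_pow_on.simps)
  then show ?thesis by (simp add: kernel_def sum_distrib_left mult_ac)
qed

lemma kernel_forward:
  assumes "x \<in> X" "y \<in> X"
  shows "((\<lambda>t. kernel t x y) has_real_derivative (\<Sum>z\<in>X. kernel t x z * T z y) - kernel t x y) (at t)"
proof -
  have "egf (\<lambda>k. pow (Suc k) x y) t = egf (\<lambda>k. \<Sum>z\<in>X. T z y * pow k x z) t"
    using assms by (simp add: pow_Suc_right mult_ac del: mat_pow_on.simps)
  also have "\<dots> = (\<Sum>z\<in>X. T z y * egf (\<lambda>k. pow k x z) t)"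
    by (rule egf_sum[where b = 1]) (rule pow_bound[OF assms(1)])
  finally have "((\<lambda>t. kernel t x y) has_real_derivative
      exp (- t) * (\<Sum>z\<in>X. T z y * egf (\<lambda>k. pow k x z) t) - exp (- t) * egf (\<lambda>k. pow k x y) t) (at t)"
    unfolding kernel_def
    by (auto intro!: derivative_eq_intros has_derivative_egf[OF pow_bound] assms simp del: mat_pow_on.simps)
  then show ?thesis by (simp add: kernel_def sum_distrib_left mult_ac)
qed

lemma kernel_0 [simp]: "kernel 0 x y = of_bool (x = y)"
  by (simp add: kernel_def)

lemma sum_kernel_0: "x \<in> X \<Longrightarrow> (\<Sum>z\<in>X. kernel 0 x z * h z) = h x"
  using finite_X by (simp add: sum_point_mass)

lemma kernel_nonneg:
  assumes "t \<ge> 0" "x \<in> X" "y \<in> X"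
  shows "0 \<le> kernel t x y"
  unfolding kernel_def egf_def using assms
  by (intro mult_nonneg_nonneg suminf_nonneg summable_egf[OF pow_bound] pow_nonneg) auto

lemma kernel_pos:
  assumes "t > 0" "x \<in> X" "y \<in> X"
  shows "0 < kernel t x y"
proof -
  obtain k where k: "pow k x y > 0"
    using irreducible assms by (auto simp: irreducible_on_def)
  have "0 < (\<Sum>k. t ^ k / fact k * pow k x y)"
    by (rule suminf_pos2[where i = k])
      (use assms k in \<open>auto simp del: times_divide_eq_left
        intro!: mult_nonneg_nonneg pow_nonneg summable_egf[OF pow_bound]\<close>)
  then show ?thesis by (simp add: kernel_def egf_def)
qed

lemma kernel_diag_ge:
  assumes "t \<ge> 0" "x \<in> X"
  shows "exp (- t) \<le> kernel t x x"
proof -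
  have "(\<Sum>k\<in>{0}. t ^ k / fact k * pow k x x) \<le> (\<Sum>k. t ^ k / fact k * pow k x x)"
    by (intro sum_le_suminf summable_egf[OF pow_bound] mult_nonneg_nonneg pow_nonneg) (use assms in auto)
  then show ?thesis by (simp add: kernel_def egf_def)
qed

lemma kernel_sum:
  assumes "x \<in> X"
  shows "(\<Sum>y\<in>X. kernel t x y) = 1"
proof -
  have "(\<Sum>y\<in>X. 1 * egf (\<lambda>k. pow k x y) t) = egf (\<lambda>k. \<Sum>y\<in>X. 1 * pow k x y) t"
    by (rule egf_sum[where b = 1, symmetric]) (rule pow_bound[OF assms])
  then have "(\<Sum>y\<in>X. egf (\<lambda>k. pow k x y) t) = exp t"
    using assms by (simp add: pow_sum egf_const_1)
  then show ?thesis by (simp add: kernel_def exp_minus flip: sum_distrib_left)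
qed

text \<open>
  The function \<open>s \<mapsto> P\<^bsub>t-s\<^esub> h\<^sub>s\<close> has zero derivative: the forward equation for the kernel cancels
  the equation assumed for \<open>h\<close>. Comparing its values at \<open>s = 0\<close> and \<open>s = t\<close> gives the claim.
  Both the semigroup property and the identification of the kernel with \<open>e\<^sup>t\<^sup>L\<close> are instances.
\<close>

lemma kernel_solves_unique:
  assumes h: "\<And>t x. x \<in> X \<Longrightarrow>
      ((\<lambda>t. h t x) has_real_derivative (\<Sum>y\<in>X. T x y * h t y) - h t x) (at t)"
    and x: "x \<in> X"
  shows "h t x = (\<Sum>z\<in>X. kernel t x z * h 0 z)"
proof -
  define \<phi> where "\<phi> s = (\<Sum>z\<in>X. kernel (t - s) x z * h s z)" for s
  have kd: "((\<lambda>s. kernel (t - s) x z) has_real_derivative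
      - ((\<Sum>w\<in>X. kernel (t - s) x w * T w z) - kernel (t - s) x z)) (at s)" if "z \<in> X" for s z
  proof -
    have "((\<lambda>s. t - s) has_real_derivative - 1) (at s)"
      by (auto intro!: derivative_eq_intros)
    from DERIV_chain2[where f = "\<lambda>t. kernel t x z" and g = "\<lambda>s. t - s" and x = s and s = UNIV,
        OF kernel_forward[OF x that, of "t - s"] this] show ?thesis by simp
  qed
  have "(\<phi> has_real_derivative 0) (at s)" for s
  proof -
    have "(\<phi> has_real_derivative
       (\<Sum>z\<in>X. - ((\<Sum>w\<in>X. kernel (t - s) x w * T w z) - kernel (t - s) x z) * h s z
         + ((\<Sum>y\<in>X. T z y * h s y) - h s z) * kernel (t - s) x z)) (at s)"
      unfolding \<phi>_def by (intro DERIV_sum DERIV_mult kd h)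
    moreover have "(\<Sum>z\<in>X. (\<Sum>w\<in>X. kernel (t - s) x w * T w z) * h s z)
        = (\<Sum>z\<in>X. (\<Sum>y\<in>X. T z y * h s y) * kernel (t - s) x z)"
      by (simp add: sum_distrib_left sum_distrib_right mult_ac) (rule sum.swap)
    ultimately show ?thesis
      by (simp add: algebra_simps sum.distrib sum_subtractf)
  qed
  then have "\<phi> t = \<phi> 0"
    using DERIV_isconst_all by blast
  then show ?thesis using x by (simp add: \<phi>_def sum_kernel_0 del: kernel_0)
qed

lemma kernel_semigroup:
  assumes "x \<in> X" "y \<in> X"
  shows "kernel (t + s) x y = (\<Sum>z\<in>X. kernel t x z * kernel s z y)"
proof -
  have "((\<lambda>t. kernel (t + s) x y) has_real_derivative
      (\<Sum>z\<in>X. T x z * kernel (t + s) z y) - kernel (t + s) x y) (at t)" if "x \<in> X" for t x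
    using kernel_backward[OF that assms(2), of "t + s"] by (simp add: DERIV_shift)
  from kernel_solves_unique[of "\<lambda>t x. kernel (t + s) x y", OF this assms(1)] show ?thesis by simp
qed

lemma generator_eq: "x \<in> X \<Longrightarrow> generator X T f x = (\<Sum>y\<in>X. T x y * f y) - f x"
  by (simp add: generator_def right_diff_distrib sum_subtractf T_sum flip: sum_distrib_right)

lemma generator_pow_bound:
  assumes "\<And>x. x \<in> X \<Longrightarrow> \<bar>f x\<bar> \<le> B" "x \<in> X"
  shows "\<bar>(generator X T ^^ k) f x\<bar> \<le> B * 2 ^ k"
  using assms(2)
proof (induction k arbitrary: x)
  case 0
  then show ?case using assms by simp
next
  case (Suc k)
  let ?g = "(generator X T ^^ k) f"
  have "\<bar>\<Sum>y\<in>X. T x y * ?g y\<bar> \<le> (\<Sum>y\<in>X. T x y * (B * 2 ^ k))"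
    by (rule order.trans[OF sum_abs sum_mono])
      (use Suc T_nonneg in \<open>auto simp: abs_mult intro!: mult_mono\<close>)
  also have "\<dots> = B * 2 ^ k"
    using T_sum[OF Suc.prems] by (simp flip: sum_distrib_right)
  finally show ?case using Suc.IH[OF Suc.prems] by (simp add: generator_eq[OF Suc.prems])
qed

theorem heat_semigroup_eq:
  assumes "x \<in> X"
  shows "heat_semigroup X T t f x = (\<Sum>y\<in>X. kernel t x y * f y)"
proof -
  define B where "B = Max ((\<lambda>x. \<bar>f x\<bar>) ` X)"
  define u where "u x k = (generator X T ^^ k) f x" for x k
  have B: "\<bar>f x\<bar> \<le> B" if "x \<in> X" for x
    unfolding B_def using finite_X that by auto
  have bound: "\<bar>u x k\<bar> \<le> B * 2 ^ k" if "x \<in> X" for x k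
    unfolding u_def by (rule generator_pow_bound[OF B that])
  have "((\<lambda>t. egf (u x) t) has_real_derivative (\<Sum>y\<in>X. T x y * egf (u y) t) - egf (u x) t) (at t)"
    if x: "x \<in> X" for t x
  proof -
    have "egf (\<lambda>k. u x (Suc k)) t = egf (\<lambda>k. (\<Sum>y\<in>X. T x y * u y k) - u x k) t"
      using generator_eq[OF x] by (simp add: u_def)
    also have "\<dots> = (\<Sum>k. (t ^ k / fact k * (\<Sum>y\<in>X. T x y * u y k)) - (t ^ k / fact k * u x k))"
      by (simp add: egf_def right_diff_distrib)
    also have "\<dots> = egf (\<lambda>k. \<Sum>y\<in>X. T x y * u y k) t - egf (u x) t"
      unfolding egf_def
    proof (rule suminf_diff [symmetric])
      show "summable (\<lambda>k. t ^ k / fact k * u x k)" by (rule summable_egf[OF bound[OF x]])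
      have "\<bar>\<Sum>y\<in>X. T x y * u y k\<bar> \<le> B * 2 ^ k" for k
      proof -
        have "\<bar>\<Sum>y\<in>X. T x y * u y k\<bar> \<le> (\<Sum>y\<in>X. T x y * (B * 2 ^ k))"
          by (rule order.trans[OF sum_abs sum_mono])
            (use x bound T_nonneg in \<open>auto simp: abs_mult intro!: mult_mono\<close>)
        then show ?thesis using T_sum[OF x] by (simp flip: sum_distrib_right)
      qed
      then show "summable (\<lambda>k. t ^ k / fact k * (\<Sum>y\<in>X. T x y * u y k))" by (rule summable_egf)
    qed
    also have "egf (\<lambda>k. \<Sum>y\<in>X. T x y * u y k) t = (\<Sum>y\<in>X. T x y * egf (u y) t)"
      by (rule egf_sum[OF bound])
    finally show ?thesis using has_derivative_egf[OF bound[OF x], of t] by simp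
  qed
  from kernel_solves_unique[of "\<lambda>t x. egf (u x) t", OF this assms, of t]
  have "egf (u x) t = (\<Sum>y\<in>X. kernel t x y * f y)" by (simp add: u_def)
  then show ?thesis by (simp add: heat_semigroup_def egf_def u_def[abs_def])
qed

end

lemma convergent_if_geometric_increments:
  fixes a :: "nat \<Rightarrow> real"
  assumes a: "\<And>n k. \<bar>a (n + k) - a n\<bar> \<le> r ^ n" and r: "0 \<le> r" "r < 1"
  shows "convergent a"
proof -
  have "Cauchy a"
  proof (rule CauchyI)
    fix e :: real assume "e > 0"
    have "(\<lambda>n. r ^ n) \<longlonglongrightarrow> 0" using r by (intro LIMSEQ_realpow_zero)
    from order_tendstoD(2)[OF this, of "e / 2"] obtain M where M: "r ^ M < e / 2"
      using \<open>e > 0\<close> by (auto simp: eventually_sequentially)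
    have "norm (a m - a n) < e" if "m \<ge> M" "n \<ge> M" for m n
      using a[of M "m - M"] a[of M "n - M"] that M by auto
    then show "\<exists>M. \<forall>m\<ge>M. \<forall>n\<ge>M. norm (a m - a n) < e" by blast
  qed
  then show ?thesis by (simp add: Cauchy_convergent_iff)
qed

context finite_chain
begin

section \<open>The stationary law\<close>

lemma law_at_eq:
  "law_at X T \<mu> t y = (if y \<in> X then \<Sum>x\<in>X. \<mu> x * kernel t x y else 0)"
proof -
  have "law_at X T \<mu> t y = (\<Sum>x\<in>X. \<mu> x * (\<Sum>z\<in>X. kernel t x z * of_bool (z = y)))"
    unfolding law_at_def by (intro sum.cong) (simp_all add: heat_semigroup_eq)
  also have "\<dots> = (if y \<in> X then \<Sum>x\<in>X. \<mu> x * kernel t x y else 0)"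
    using finite_X by (auto simp: sum_point_mass intro!: sum.neutral)
  finally show ?thesis .
qed

lemma law_at_0: "law_on X \<mu> \<Longrightarrow> law_at X T \<mu> 0 = \<mu>"
  using finite_X by (auto simp: law_at_eq fun_eq_iff law_on_def sum_point_mass)

lemma law_on_law_at:
  assumes "law_on X \<mu>" "t \<ge> 0"
  shows "law_on X (law_at X T \<mu> t)"
proof -
  have "(\<Sum>y\<in>X. law_at X T \<mu> t y) = (\<Sum>x\<in>X. \<mu> x * (\<Sum>y\<in>X. kernel t x y))"
    by (simp add: law_at_eq sum_distrib_left) (rule sum.swap)
  also have "\<dots> = 1" using assms by (simp add: kernel_sum law_on_def)
  finally show ?thesis
    using assms by (auto simp: law_on_def law_at_eq intro!: sum_nonneg mult_nonneg_nonneg kernel_nonneg)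
qed

lemma law_at_pos:
  assumes "law_on X \<mu>" "t > 0" "y \<in> X"
  shows "law_at X T \<mu> t y > 0"
proof -
  obtain x where x: "x \<in> X" "\<mu> x > 0"
    using assms(1) sum_nonpos[of X \<mu>] by (force simp: law_on_def not_less)
  have "0 < \<mu> x * kernel t x y" using x assms by (simp add: kernel_pos)
  also have "\<dots> \<le> (\<Sum>x\<in>X. \<mu> x * kernel t x y)"
    by (rule member_le_sum)
      (use x assms finite_X in \<open>auto simp: law_on_def intro!: mult_nonneg_nonneg kernel_nonneg\<close>)
  finally show ?thesis using assms by (simp add: law_at_eq)
qed

lemma law_at_add:
  assumes "law_on X \<mu>"
  shows "law_at X T \<mu> (t + s) = law_at X T (law_at X T \<mu> t) s"
proof
  fix y
  have "(\<Sum>x\<in>X. \<mu> x * kernel (t + s) x y) = (\<Sum>z\<in>X. (\<Sum>x\<in>X. \<mu> x * kernel t x z) * kernel s z y)"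
    if "y \<in> X"
    using that by (simp add: kernel_semigroup sum_distrib_left sum_distrib_right mult.assoc) (rule sum.swap)
  then show "law_at X T \<mu> (t + s) y = law_at X T (law_at X T \<mu> t) s y"
    by (simp add: law_at_eq)
qed

lemma law_at_deriv:
  assumes "y \<in> X"
  shows "((\<lambda>t. law_at X T \<mu> t y) has_real_derivative
    (\<Sum>x\<in>X. law_at X T \<mu> t x * T x y) - law_at X T \<mu> t y) (at t)"
proof -
  have "((\<lambda>t. \<Sum>x\<in>X. \<mu> x * kernel t x y) has_real_derivative
      (\<Sum>x\<in>X. \<mu> x * ((\<Sum>z\<in>X. kernel t x z * T z y) - kernel t x y))) (at t)"
    by (intro DERIV_sum DERIV_cmult kernel_forward assms)
  moreover have "(\<Sum>x\<in>X. \<mu> x * (\<Sum>z\<in>X. kernel t x z * T z y))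
      = (\<Sum>z\<in>X. (\<Sum>x\<in>X. \<mu> x * kernel t x z) * T z y)"
    by (simp add: sum_distrib_left sum_distrib_right mult.assoc) (rule sum.swap)
  ultimately show ?thesis using assms by (simp add: law_at_eq right_diff_distrib sum_subtractf)
qed

lemma law_on_point_mass: "o' \<in> X \<Longrightarrow> law_on X (\<lambda>x. of_bool (x = o'))"
  using finite_X sum_point_mass(2)[of X o' "\<lambda>_. 1"] by (auto simp: law_on_def)

lemma law_at_point_mass: "o' \<in> X \<Longrightarrow> y \<in> X \<Longrightarrow> law_at X T (\<lambda>x. of_bool (x = o')) t y = kernel t o' y"
  using finite_X by (simp add: law_at_eq sum_point_mass)

text \<open>
  Doeblin's argument: all entries of \<open>P\<^sub>1\<close> are at least some \<open>\<alpha> > 0\<close>, and the common part of its rows,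
  of mass \<open>\<alpha> * card X\<close>, contributes nothing to the oscillation of \<open>P\<^sub>1 g\<close>.
\<close>

lemma kernel_1_contracts:
  "\<exists>r. 0 \<le> r \<and> r < 1 \<and> (\<forall>g D. (\<forall>x\<in>X. \<forall>x'\<in>X. g x - g x' \<le> D) \<longrightarrow>
     (\<forall>x\<in>X. \<forall>x'\<in>X. (\<Sum>z\<in>X. kernel 1 x z * g z) - (\<Sum>z\<in>X. kernel 1 x' z * g z) \<le> r * D))"
proof -
  define \<alpha> where "\<alpha> = Min ((\<lambda>(x, y). kernel 1 x y) ` (X \<times> X))"
  define r where "r = 1 - real (card X) * \<alpha>"
  have \<alpha>_le: "\<alpha> \<le> kernel 1 x y" if "x \<in> X" "y \<in> X" for x y
    unfolding \<alpha>_def using finite_X that by (intro Min_le) auto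
  have "\<alpha> > 0"
    unfolding \<alpha>_def using finite_X X_ne by (subst Min_gr_iff) (auto simp: kernel_pos)
  have row: "(\<Sum>z\<in>X. kernel 1 x z - \<alpha>) = r" if "x \<in> X" for x
    using that by (simp add: r_def sum_subtractf kernel_sum)
  have "r \<ge> 0"
  proof -
    obtain x where x: "x \<in> X" using X_ne by auto
    then have "0 \<le> (\<Sum>z\<in>X. kernel 1 x z - \<alpha>)" using \<alpha>_le by (intro sum_nonneg) auto
    then show ?thesis using row[OF x] by simp
  qed
  moreover have "r < 1"
    using \<open>\<alpha> > 0\<close> X_ne finite_X by (simp add: r_def card_gt_0_iff)
  moreover have "(\<Sum>z\<in>X. kernel 1 x z * g z) - (\<Sum>z\<in>X. kernel 1 x' z * g z) \<le> r * D"
    if g: "\<And>x x'. x \<in> X \<Longrightarrow> x' \<in> X \<Longrightarrow> g x - g x' \<le> D" and x: "x \<in> X" "x' \<in> X" for g D x x'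
  proof -
    have "Min (g ` X) \<in> g ` X" using finite_X X_ne by (intro Min_in) auto
    then obtain w where w: "w \<in> X" "g w = Min (g ` X)" by auto
    have w_le: "g w \<le> g z" if "z \<in> X" for z
      using w finite_X that by simp
    have expand: "(\<Sum>z\<in>X. (kernel 1 v z - \<alpha>) * (g z - g w))
        = (\<Sum>z\<in>X. kernel 1 v z * g z) - \<alpha> * (\<Sum>z\<in>X. g z) - r * g w" if "v \<in> X" for v
    proof -
      have "(\<Sum>z\<in>X. (kernel 1 v z - \<alpha>) * (g z - g w))
          = (\<Sum>z\<in>X. (kernel 1 v z * g z - \<alpha> * g z) - (kernel 1 v z - \<alpha>) * g w)"
        by (intro sum.cong) (auto simp: algebra_simps)
      also have "\<dots> = (\<Sum>z\<in>X. kernel 1 v z * g z) - \<alpha> * (\<Sum>z\<in>X. g z) - (\<Sum>z\<in>X. kernel 1 v z - \<alpha>) * g w"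
        by (simp only: sum_distrib_left sum_distrib_right) (simp only: sum_subtractf)
      finally show ?thesis using row[OF that] by simp
    qed
    have "(\<Sum>z\<in>X. (kernel 1 x z - \<alpha>) * (g z - g w)) \<le> (\<Sum>z\<in>X. (kernel 1 x z - \<alpha>) * D)"
      by (intro sum_mono mult_left_mono g w) (use \<alpha>_le x in auto)
    also have "\<dots> = r * D" using row[OF x(1)] by (simp flip: sum_distrib_right)
    moreover have "0 \<le> (\<Sum>z\<in>X. (kernel 1 x' z - \<alpha>) * (g z - g w))"
      by (intro sum_nonneg mult_nonneg_nonneg) (use \<alpha>_le x w_le in auto)
    ultimately show ?thesis using expand x by simp
  qed
  ultimately show ?thesis by blast
qed

text \<open>
  The oscillation of \<open>x \<mapsto> P\<^sub>n(x, y)\<close> decays geometrically, and \<open>P\<^bsub>n+k\<^esub>(x, y)\<close> is an average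
  over \<open>z\<close> of \<open>P\<^sub>n(z, y)\<close>, hence within that oscillation of \<open>P\<^sub>n(x, y)\<close>.
\<close>

lemma kernel_converges:
  "\<exists>L. \<forall>x\<in>X. \<forall>y\<in>X. (\<lambda>n. kernel (real n) x y) \<longlonglongrightarrow> L y"
proof -
  obtain r where r: "0 \<le> r" "r < 1"
    and contr: "\<forall>g D. (\<forall>x\<in>X. \<forall>x'\<in>X. g x - g x' \<le> D) \<longrightarrow>
     (\<forall>x\<in>X. \<forall>x'\<in>X. (\<Sum>z\<in>X. kernel 1 x z * g z) - (\<Sum>z\<in>X. kernel 1 x' z * g z) \<le> r * D)"
    using kernel_1_contracts by auto
  have osc: "kernel (real n) x y - kernel (real n) x' y \<le> r ^ n"
    if y: "y \<in> X" and "x \<in> X" "x' \<in> X" for n x x' y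
    using that(2,3)
  proof (induction n arbitrary: x x')
    case 0
    then show ?case by simp
  next
    case (Suc n)
    have "(\<Sum>z\<in>X. kernel 1 x z * kernel (real n) z y) - (\<Sum>z\<in>X. kernel 1 x' z * kernel (real n) z y) \<le> r * r ^ n"
      using contr[rule_format, of "\<lambda>z. kernel (real n) z y" "r ^ n" x x'] Suc by blast
    then show ?case using kernel_semigroup[of _ y 1 "real n"] Suc.prems y by (simp add: add.commute)
  qed
  obtain x0 where x0: "x0 \<in> X" using X_ne by auto
  have "convergent (\<lambda>n. kernel (real n) x0 y)" if y: "y \<in> X" for y
  proof (rule convergent_if_geometric_increments[OF _ r])
    fix n k :: nat
    have "kernel (real (n + k)) x0 y - kernel (real n) x0 y
        = (\<Sum>z\<in>X. kernel (real k) x0 z * (kernel (real n) z y - kernel (real n) x0 y))"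
      using kernel_semigroup[OF x0 y, of "real k" "real n"] kernel_sum[OF x0, of "real k"]
      by (simp add: right_diff_distrib sum_subtractf add.commute flip: sum_distrib_right)
    also have "\<bar>\<dots>\<bar> \<le> (\<Sum>z\<in>X. kernel (real k) x0 z * r ^ n)"
      by (rule order.trans[OF sum_abs sum_mono])
        (use x0 y osc[OF y, of _ x0 n] osc[OF y x0, of _ n] kernel_nonneg[OF _ x0, of "real k"] in
          \<open>auto simp: abs_mult abs_le_iff intro!: mult_mono\<close>)
    also have "\<dots> = r ^ n" using kernel_sum[OF x0] by (simp flip: sum_distrib_right)
    finally show "\<bar>kernel (real (n + k)) x0 y - kernel (real n) x0 y\<bar> \<le> r ^ n" .
  qed
  then have L: "(\<lambda>n. kernel (real n) x0 y) \<longlonglongrightarrow> lim (\<lambda>n. kernel (real n) x0 y)" if "y \<in> X" for y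
    using that convergent_LIMSEQ_iff by auto
  show ?thesis
  proof (intro exI ballI)
    fix x y assume xy: "x \<in> X" "y \<in> X"
    have "(\<lambda>n. kernel (real n) x y - kernel (real n) x0 y) \<longlonglongrightarrow> 0"
    proof (rule Lim_null_comparison)
      show "(\<lambda>n. r ^ n) \<longlonglongrightarrow> 0" using r by (intro LIMSEQ_realpow_zero)
      show "\<forall>\<^sub>F n in sequentially. norm (kernel (real n) x y - kernel (real n) x0 y) \<le> r ^ n"
        using osc[OF xy(2,1) x0] osc[OF xy(2) x0 xy(1)] by (auto simp: abs_le_iff)
    qed
    from tendsto_add[OF this L[OF xy(2)]]
    show "(\<lambda>n. kernel (real n) x y) \<longlonglongrightarrow> lim (\<lambda>n. kernel (real n) x0 y)" by simp
  qed
qed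

text \<open>
  The limit of \<open>P\<^sub>n(x, \<sqdot>)\<close> does not depend on \<open>x\<close>. Passing to the limit in
  \<open>P\<^sub>n P\<^sub>t = P\<^sub>t P\<^sub>n\<close> shows that it is stationary, and passing to the limit in \<open>q P\<^sub>n = q\<close> shows that
  it is the only stationary law.
\<close>

lemma stationary_law_ex1: "\<exists>!p. law_on X p \<and> (\<forall>t\<ge>0. law_at X T p t = p)"
proof -
  obtain L where L: "\<And>x y. x \<in> X \<Longrightarrow> y \<in> X \<Longrightarrow> (\<lambda>n. kernel (real n) x y) \<longlonglongrightarrow> L y"
    using kernel_converges by blast
  define p where "p y = (if y \<in> X then L y else 0)" for y
  obtain x0 where x0: "x0 \<in> X" using X_ne by auto
  have "law_on X p"
  proof -
    have "L y \<ge> 0" if "y \<in> X" for y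
      by (rule LIMSEQ_le_const[OF L[OF x0 that]]) (use x0 that kernel_nonneg in auto)
    moreover have "(\<lambda>n. \<Sum>y\<in>X. kernel (real n) x0 y) \<longlonglongrightarrow> (\<Sum>y\<in>X. L y)"
      by (intro tendsto_sum L x0)
    then have "(\<Sum>y\<in>X. L y) = 1"
      using kernel_sum[OF x0] by (simp add: LIMSEQ_const_iff)
    ultimately show ?thesis by (auto simp: law_on_def p_def)
  qed
  moreover have "law_at X T p t = p" for t
  proof
    fix y
    show "law_at X T p t y = p y"
    proof (cases "y \<in> X")
      case y: True
      have "(\<lambda>n. \<Sum>x\<in>X. kernel (real n) x0 x * kernel t x y) \<longlonglongrightarrow> (\<Sum>x\<in>X. L x * kernel t x y)"
        by (intro tendsto_intros L x0)
      moreover have "(\<lambda>n. \<Sum>z\<in>X. kernel t x0 z * kernel (real n) z y) \<longlonglongrightarrow> (\<Sum>z\<in>X. kernel t x0 z * L y)"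
        by (intro tendsto_intros L y)
      moreover have "(\<Sum>x\<in>X. kernel (real n) x0 x * kernel t x y)
          = (\<Sum>z\<in>X. kernel t x0 z * kernel (real n) z y)" for n
        using kernel_semigroup[OF x0 y, of "real n" t] kernel_semigroup[OF x0 y, of t "real n"]
        by (simp add: add.commute)
      ultimately have "(\<Sum>x\<in>X. L x * kernel t x y) = (\<Sum>z\<in>X. kernel t x0 z * L y)"
        by (simp add: LIMSEQ_unique)
      also have "\<dots> = L y" using kernel_sum[OF x0] by (simp flip: sum_distrib_right)
      finally show ?thesis using y by (simp add: law_at_eq p_def)
    qed (simp add: law_at_eq p_def)
  qed
  moreover have "q = p" if q: "law_on X q" "\<forall>t\<ge>0. law_at X T q t = q" for q
  proof
    fix y
    show "q y = p y"
    proof (cases "y \<in> X")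
      case y: True
      have "(\<lambda>n. \<Sum>x\<in>X. q x * kernel (real n) x y) \<longlonglongrightarrow> (\<Sum>x\<in>X. q x * L y)"
        by (intro tendsto_intros L y)
      moreover have "(\<Sum>x\<in>X. q x * kernel (real n) x y) = q y" for n
        using q(2)[rule_format, of "real n"] y by (metis law_at_eq of_nat_0_le_iff)
      ultimately have "q y = (\<Sum>x\<in>X. q x * L y)" by (simp add: LIMSEQ_const_iff)
      then show ?thesis using q y by (simp add: law_on_def p_def flip: sum_distrib_right)
    qed (use q in \<open>auto simp: law_on_def p_def\<close>)
  qed
  ultimately show ?thesis by blast
qed

abbreviation "stat \<equiv> stationary_law X T"

lemma stat_law: "law_on X stat"
  and law_at_stat: "t \<ge> 0 \<Longrightarrow> law_at X T stat t = stat"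
  using theI'[OF stationary_law_ex1] by (auto simp: stationary_law_def)

lemma stat_pos: "x \<in> X \<Longrightarrow> 0 < stat x"
  using law_at_pos[OF stat_law, of 1 x] by (simp add: law_at_stat)

lemma stat_sum: "(\<Sum>x\<in>X. stat x) = 1"
  using stat_law by (simp add: law_on_def)

lemma stat_balance:
  assumes "y \<in> X"
  shows "(\<Sum>x\<in>X. stat x * T x y) = stat y"
proof -
  have "((\<lambda>t. law_at X T stat t y) has_real_derivative (\<Sum>x\<in>X. stat x * T x y) - stat y) (at 1)"
    using law_at_deriv[OF assms, of stat 1] by (simp add: law_at_stat)
  moreover have "((\<lambda>t. law_at X T stat t y) has_real_derivative 0) (at 1)"
    by (rule has_field_derivative_transform_within_open[where f = "\<lambda>_. stat y" and S = "{0<..}"])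
      (auto simp: law_at_stat)
  ultimately show ?thesis using DERIV_unique by force
qed

text \<open>
  With \<open>symmetric_support\<close> this bounds the ratio of stationary weights of neighbours by the degree.
\<close>

lemma stat_flow_le: "x \<in> X \<Longrightarrow> y \<in> X \<Longrightarrow> stat y * T y x \<le> stat x"
  using member_le_sum[of y X "\<lambda>y. stat y * T y x"] stat_balance[of x] stat_pos T_nonneg finite_X
  by force

section \<open>Total variation\<close>

lemma TV_le:
  assumes "\<And>A. A \<subseteq> X \<Longrightarrow> \<bar>(\<Sum>x\<in>A. \<mu> x) - (\<Sum>x\<in>A. stat x)\<bar> \<le> e"
  shows "TV X T \<mu> \<le> e"
  unfolding TV_def by (rule cSUP_least) (use assms in auto)

lemma TV_ge: "A \<subseteq> X \<Longrightarrow> \<bar>(\<Sum>x\<in>A. \<mu> x) - (\<Sum>x\<in>A. stat x)\<bar> \<le> TV X T \<mu>"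
  unfolding TV_def using finite_X by (intro cSUP_upper bdd_above_finite) auto

lemma TV_le_iff:
  "TV X T \<mu> \<le> e \<longleftrightarrow> (\<forall>A\<in>Pow X. \<bar>(\<Sum>x\<in>A. \<mu> x) - (\<Sum>x\<in>A. stat x)\<bar> \<le> e)"
  using TV_le TV_ge by (meson PowD PowI order.trans)

text \<open>
  Among test functions with values in \<open>[0, 1]\<close> the indicator of \<open>{\<mu> \<ge> \<pi>}\<close> and that of its
  complement are extremal.
\<close>

lemma TV_test_function:
  assumes g: "\<And>x. x \<in> X \<Longrightarrow> 0 \<le> g x \<and> g x \<le> 1"
  shows "\<bar>\<Sum>x\<in>X. (\<mu> x - stat x) * g x\<bar> \<le> TV X T \<mu>"
proof -
  define A where "A = {x\<in>X. \<mu> x \<ge> stat x}"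
  have A: "A \<subseteq> X" by (auto simp: A_def)
  have split: "sum h X = sum h A + sum h (X - A)" for h :: "'a \<Rightarrow> real"
    using sum.subset_diff[OF A finite_X, of h] by simp
  have "(\<Sum>x\<in>X. (\<mu> x - stat x) * g x) \<le> (\<Sum>x\<in>A. \<mu> x - stat x) + (\<Sum>x\<in>X - A. 0)"
    unfolding split
    by (intro add_mono sum_mono) (use g in \<open>auto simp: A_def mult_left_le mult_nonpos_nonneg\<close>)
  also have "\<dots> \<le> TV X T \<mu>" using TV_ge[OF A, of \<mu>] by (simp add: sum_subtractf)
  finally have upper: "(\<Sum>x\<in>X. (\<mu> x - stat x) * g x) \<le> TV X T \<mu>" .
  have "(\<Sum>x\<in>A. 0) + (\<Sum>x\<in>X - A. \<mu> x - stat x) \<le> (\<Sum>x\<in>X. (\<mu> x - stat x) * g x)"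
  proof (unfold split, intro add_mono sum_mono)
    fix x assume "x \<in> X - A"
    then have "(stat x - \<mu> x) * g x \<le> (stat x - \<mu> x) * 1"
      using g by (intro mult_left_mono) (auto simp: A_def)
    then show "\<mu> x - stat x \<le> (\<mu> x - stat x) * g x" by (simp add: algebra_simps)
  qed (use g in \<open>auto simp: A_def\<close>)
  moreover have "- TV X T \<mu> \<le> (\<Sum>x\<in>X - A. \<mu> x - stat x)"
    using TV_ge[of "X - A" \<mu>] by (simp add: sum_subtractf)
  ultimately show ?thesis using upper by simp
qed

lemma TV_law_at_le:
  assumes "law_on X \<mu>" "t \<ge> 0"
  shows "TV X T (law_at X T \<mu> t) \<le> TV X T \<mu>"
proof (rule TV_le)
  fix A assume A: "A \<subseteq> X"
  have "(\<Sum>y\<in>A. law_at X T \<nu> t y) = (\<Sum>x\<in>X. \<nu> x * (\<Sum>y\<in>A. kernel t x y))" for \<nu>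
  proof -
    have "(\<Sum>y\<in>A. law_at X T \<nu> t y) = (\<Sum>y\<in>A. \<Sum>x\<in>X. \<nu> x * kernel t x y)"
      using A by (intro sum.cong) (auto simp: law_at_eq)
    also have "\<dots> = (\<Sum>x\<in>X. \<Sum>y\<in>A. \<nu> x * kernel t x y)" by (rule sum.swap)
    finally show ?thesis by (simp add: sum_distrib_left)
  qed
  from this[of \<mu>] this[of stat]
  have "(\<Sum>y\<in>A. law_at X T \<mu> t y) - (\<Sum>y\<in>A. stat y) = (\<Sum>x\<in>X. (\<mu> x - stat x) * (\<Sum>y\<in>A. kernel t x y))"
    using assms by (simp add: law_at_stat left_diff_distrib sum_subtractf)
  moreover have "(\<Sum>y\<in>A. kernel t x y) \<le> 1" if "x \<in> X" for x
    using sum_mono2[OF finite_X A, of "kernel t x"] kernel_sum[OF that, of t] kernel_nonneg that assms by auto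
  then have "\<bar>\<Sum>x\<in>X. (\<mu> x - stat x) * (\<Sum>y\<in>A. kernel t x y)\<bar> \<le> TV X T \<mu>"
    using A assms by (intro TV_test_function) (auto intro!: sum_nonneg kernel_nonneg)
  ultimately show "\<bar>(\<Sum>y\<in>A. law_at X T \<mu> t y) - (\<Sum>y\<in>A. stat y)\<bar> \<le> TV X T \<mu>" by simp
qed

lemma TV_mono_time:
  assumes "law_on X \<mu>" "0 \<le> s" "s \<le> t"
  shows "TV X T (law_at X T \<mu> t) \<le> TV X T (law_at X T \<mu> s)"
  using TV_law_at_le[OF law_on_law_at[OF assms(1,2)], of "t - s"] law_at_add[OF assms(1), of s "t - s"]
    assms by simp

text \<open>
  Closedness is what makes the least element in the definition of \<open>t_mix_from\<close> exist.
\<close>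

lemma closed_TV_sublevel: "closed {t. t \<ge> 0 \<and> TV X T (law_at X T \<mu> t) \<le> e}"
proof -
  have cont: "continuous_on UNIV (\<lambda>t. law_at X T \<mu> t y)" for y
  proof (cases "y \<in> X")
    case True
    then show ?thesis using law_at_deriv DERIV_isCont by (meson continuous_at_imp_continuous_on)
  qed (simp add: law_at_eq)
  have "{t. t \<ge> 0 \<and> TV X T (law_at X T \<mu> t) \<le> e} = {0..} \<inter>
      (\<Inter>A\<in>Pow X. {t. \<bar>(\<Sum>x\<in>A. law_at X T \<mu> t x) - (\<Sum>x\<in>A. stat x)\<bar> \<le> e})"
    by (auto simp: TV_le_iff)
  also have "closed \<dots>"
    by (intro closed_Int closed_INT ballI closed_Collect_le continuous_intros cont)
  finally show ?thesis .
qed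

end

section \<open>Relative entropy\<close>

lemma abs_diff_eq_sqrt:
  fixes a b :: real
  assumes "0 \<le> a" "0 \<le> b"
  shows "\<bar>a - b\<bar> = \<bar>sqrt a - sqrt b\<bar> * (sqrt a + sqrt b)"
proof -
  have "a - b = (sqrt a - sqrt b) * (sqrt a + sqrt b)"
    using assms by (simp add: algebra_simps)
  then show ?thesis using assms by (simp add: abs_mult)
qed

text \<open>
  This is \<open>ln r \<le> r - 1\<close> at \<open>r = sqrt (b / a)\<close>. Taken pointwise and summed it compares both the
  entropy and its dissipation with sums of squared differences of square roots.
\<close>

lemma entropy_integrand_ge:
  fixes a b :: real
  assumes "0 \<le> a" "0 < b"
  shows "a - b + (sqrt a - sqrt b)\<^sup>2 \<le> a * ln (a / b)"
proof (cases "a = 0")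
  case True
  then show ?thesis using assms by simp
next
  case False
  with assms have a: "a > 0" by simp
  have "ln (sqrt (b / a)) \<le> sqrt (b / a) - 1"
    using a assms by (intro ln_le_minus_one) auto
  then have "- ln (a / b) \<le> 2 * (sqrt (b / a) - 1)"
    using a assms by (simp add: ln_sqrt ln_div)
  from mult_left_mono[OF this, of a] have "2 * a - 2 * (a * sqrt (b / a)) \<le> a * ln (a / b)"
    using a by (simp add: algebra_simps)
  moreover have "a * sqrt (b / a) = sqrt a * sqrt b"
  proof -
    have "a * sqrt (b / a) = sqrt a * (sqrt a * sqrt (b / a))"
      using a by (simp flip: mult.assoc)
    also have "sqrt a * sqrt (b / a) = sqrt b" using a by (simp flip: real_sqrt_mult)
    finally show ?thesis .
  qed
  ultimately show ?thesis using a assms by (simp add: power2_eq_square algebra_simps)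
qed

context finite_chain
begin

lemma Ent_ge_hellinger:
  assumes "law_on X \<mu>"
  shows "(\<Sum>x\<in>X. (sqrt (\<mu> x) - sqrt (stat x))\<^sup>2) \<le> Ent X T \<mu>"
proof -
  have "(\<Sum>x\<in>X. \<mu> x - stat x + (sqrt (\<mu> x) - sqrt (stat x))\<^sup>2) \<le> Ent X T \<mu>"
    unfolding Ent_def
    by (intro sum_mono entropy_integrand_ge) (use assms stat_pos in \<open>auto simp: law_on_def\<close>)
  then show ?thesis using assms by (simp add: sum.distrib sum_subtractf law_on_def stat_sum)
qed

lemma Ent_nonneg: "law_on X \<mu> \<Longrightarrow> 0 \<le> Ent X T \<mu>"
  using Ent_ge_hellinger by (meson order.trans sum_nonneg zero_le_power2)

text \<open>
  A form of Pinsker's inequality through the Hellinger distance, by Cauchy-Schwarz for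
  \<open>\<mu> - \<pi> = (sqrt \<mu> - sqrt \<pi>) (sqrt \<mu> + sqrt \<pi>)\<close>.
\<close>

lemma TV_le_sqrt_Ent:
  assumes \<mu>: "law_on X \<mu>"
  shows "TV X T \<mu> \<le> 2 * sqrt (Ent X T \<mu>)"
proof (rule TV_le)
  fix A assume A: "A \<subseteq> X"
  let ?u = "\<lambda>x. \<bar>sqrt (\<mu> x) - sqrt (stat x)\<bar>" and ?v = "\<lambda>x. sqrt (\<mu> x) + sqrt (stat x)"
  have pos: "0 \<le> \<mu> x" "0 \<le> stat x" if "x \<in> X" for x
    using \<mu> stat_law that by (auto simp: law_on_def)
  have "\<bar>(\<Sum>x\<in>A. \<mu> x) - (\<Sum>x\<in>A. stat x)\<bar> \<le> (\<Sum>x\<in>A. \<bar>\<mu> x - stat x\<bar>)"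
    by (simp flip: sum_subtractf)
  also have "\<dots> \<le> (\<Sum>x\<in>X. \<bar>\<mu> x - stat x\<bar>)"
    by (rule sum_mono2[OF finite_X A]) auto
  also have "\<dots> = (\<Sum>x\<in>X. ?u x * ?v x)"
    by (intro sum.cong refl abs_diff_eq_sqrt pos)
  also have "\<dots> \<le> sqrt ((\<Sum>x\<in>X. (?u x)\<^sup>2) * (\<Sum>x\<in>X. (?v x)\<^sup>2))"
    using Cauchy_Schwarz_ineq_sum[of ?u ?v X] by (intro real_le_rsqrt)
  also have "\<dots> \<le> sqrt (Ent X T \<mu> * 4)"
  proof (intro real_sqrt_le_mono mult_mono)
    have "(\<Sum>x\<in>X. (?v x)\<^sup>2) \<le> (\<Sum>x\<in>X. 2 * \<mu> x + 2 * stat x)"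
    proof (rule sum_mono)
      fix x assume x: "x \<in> X"
      show "(?v x)\<^sup>2 \<le> 2 * \<mu> x + 2 * stat x"
        using pos[OF x] zero_le_power2[of "sqrt (\<mu> x) - sqrt (stat x)"]
        by (simp add: power2_diff power2_sum)
    qed
    then show "(\<Sum>x\<in>X. (?v x)\<^sup>2) \<le> 4"
      using \<mu> stat_sum by (simp add: sum.distrib law_on_def flip: sum_distrib_left)
  qed (use Ent_ge_hellinger[OF \<mu>] Ent_nonneg[OF \<mu>] in \<open>auto intro: sum_nonneg\<close>)
  finally show "\<bar>(\<Sum>x\<in>A. \<mu> x) - (\<Sum>x\<in>A. stat x)\<bar> \<le> 2 * sqrt (Ent X T \<mu>)"
    by (simp add: real_sqrt_mult)
qed

end

text \<open>
  The bound vanishes as \<open>v \<rightarrow> 0\<close>. It is needed because the chain starts from a point mass: the entropy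
  is differentiable at positive times only, and continuity has to bridge the gap at time \<open>0\<close>.
\<close>

lemma entropy_integrand_small:
  fixes c v :: real
  assumes "0 \<le> v" "v \<le> c" "c > 0"
  shows "\<bar>v * ln (v / c)\<bar> \<le> 2 * sqrt (c * v)"
proof (cases "v = 0")
  case False
  then have v: "v > 0" using assms by simp
  have "ln (sqrt (c / v)) \<le> sqrt (c / v)"
    using ln_le_minus_one[of "sqrt (c / v)"] v assms by simp
  then have "- ln (v / c) \<le> 2 * sqrt (c / v)"
    using v assms by (simp add: ln_sqrt ln_div)
  from mult_left_mono[OF this, of v] have "- (v * ln (v / c)) \<le> 2 * (v * sqrt (c / v))"
    using v by (simp add: algebra_simps)
  moreover have "v * sqrt (c / v) = sqrt (c * v)"
  proof -
    have "v * sqrt (c / v) = sqrt (v\<^sup>2 * (c / v))"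
      using v by (simp add: real_sqrt_mult real_sqrt_divide)
    also have "v\<^sup>2 * (c / v) = c * v" using v by (simp add: power2_eq_square)
    finally show ?thesis .
  qed
  moreover have "v * ln (v / c) \<le> 0"
    using v assms by (intro mult_nonneg_nonpos) auto
  ultimately show ?thesis by simp
qed simp

lemma continuous_on_entropy_integrand:
  fixes c :: real
  assumes "c > 0"
  shows "continuous_on {0..} (\<lambda>v. v * ln (v / c))"
  unfolding continuous_on_eq_continuous_within
proof
  fix v :: real assume "v \<in> {0..}"
  show "continuous (at v within {0..}) (\<lambda>v. v * ln (v / c))"
  proof (cases "v = 0")
    case True
    have "((\<lambda>v. v * ln (v / c)) \<longlongrightarrow> 0) (at 0 within {0..})"
    proof (rule Lim_null_comparison)
      have "eventually (\<lambda>v. v < c) (at 0 within {0..})"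
        using assms by (intro order_tendstoD(2)[OF tendsto_ident_at]) auto
      moreover have "eventually (\<lambda>v::real. v \<in> {0..}) (at 0 within {0..})"
        by (simp add: eventually_at_filter)
      ultimately show "\<forall>\<^sub>F v in at 0 within {0..}. norm (v * ln (v / c)) \<le> 2 * sqrt (c * v)"
        by eventually_elim (use assms entropy_integrand_small in auto)
      have "((\<lambda>v. 2 * sqrt (c * v)) \<longlongrightarrow> 2 * sqrt (c * 0)) (at 0 within {0..})"
        by (intro tendsto_intros)
      then show "((\<lambda>v. 2 * sqrt (c * v)) \<longlongrightarrow> 0) (at 0 within {0..})" by simp
    qed
    then show ?thesis using True by (simp add: continuous_within)
  next
    case False
    with \<open>v \<in> {0..}\<close> have "v > 0" by simp
    then have "isCont (\<lambda>v. v * ln (v / c)) v"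
      using assms by (intro continuous_intros) auto
    then show ?thesis by (rule continuous_at_imp_continuous_within)
  qed
qed

text \<open>
  With \<open>u\<close> the increment of the log-density along a jump, \<open>Phi u\<close> is the rate at which that jump
  dissipates entropy, whereas the carre du champ of the log-density involves \<open>u\<^sup>2 / 2\<close>.
\<close>

definition Phi :: "real \<Rightarrow> real" where "Phi u = exp u - 1 - u"

lemma Phi_nonneg: "0 \<le> Phi u"
  unfolding Phi_def using exp_ge_add_one_self[of u] by linarith

text \<open>
  For diffusions \<open>u\<close> is infinitesimal and the two quantities agree. In general \<open>Phi u\<close> grows only
  linearly as \<open>u \<rightarrow> -\<infinity>\<close>, so the quadratic bound costs a factor of the order of the largest downward
  jump \<open>R\<close>. Upward jumps are harmless: \<open>Phi u \<ge> u\<^sup>2 / 2\<close> for \<open>u \<ge> 0\<close>.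
\<close>

lemma sq_le_Phi:
  assumes "- R \<le> u" "0 \<le> R"
  shows "u\<^sup>2 \<le> 2 * (1 + R) * Phi u"
proof (cases "u \<ge> 0")
  case True
  then have "u\<^sup>2 \<le> 2 * Phi u"
    using exp_lower_Taylor_quadratic[of u] by (simp add: Phi_def)
  also have "\<dots> \<le> 2 * (1 + R) * Phi u"
    using assms Phi_nonneg[of u] by (intro mult_right_mono) auto
  finally show ?thesis .
next
  case False
  define h where "h s = (1 + s) * exp (- s) + s\<^sup>2 / 2" for s :: real
  define s where "s = - u"
  have s: "0 \<le> s" "s \<le> R" using False assms by (auto simp: s_def)
  have "h 0 \<le> h s"
  proof (rule DERIV_nonneg_imp_nondecreasing[OF s(1)])
    fix r :: real assume r: "0 \<le> r"
    have "(h has_real_derivative r * (1 - exp (- r))) (at r)"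
      unfolding h_def by (auto intro!: derivative_eq_intros simp: algebra_simps)
    moreover have "0 \<le> r * (1 - exp (- r))" using r by simp
    ultimately show "\<exists>y. DERIV h r :> y \<and> 0 \<le> y" by blast
  qed
  then have "s\<^sup>2 \<le> 2 * (1 + s) * Phi (- s)"
    by (simp add: h_def Phi_def algebra_simps power2_eq_square)
  also have "\<dots> \<le> 2 * (1 + R) * Phi (- s)"
    using s Phi_nonneg[of "- s"] by (intro mult_right_mono) auto
  finally show ?thesis by (simp add: s_def)
qed

context finite_chain
begin

definition log_density :: "('a \<Rightarrow> real) \<Rightarrow> 'a \<Rightarrow> real" where
  "log_density \<nu> x = ln (\<nu> x / stat x)"

definition dissipation :: "('a \<Rightarrow> real) \<Rightarrow> real" where
  "dissipation \<nu> = (\<Sum>x\<in>X. \<nu> x * (\<Sum>y\<in>X. T x y * Phi (log_density \<nu> y - log_density \<nu> x)))"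

lemma dissipation_nonneg: "law_on X \<nu> \<Longrightarrow> 0 \<le> dissipation \<nu>"
  unfolding dissipation_def law_on_def
  by (intro sum_nonneg mult_nonneg_nonneg Phi_nonneg T_nonneg) auto

lemma Ent_eq: "Ent X T \<nu> = (\<Sum>x\<in>X. \<nu> x * log_density \<nu> x)"
  by (simp add: Ent_def log_density_def)

text \<open>
  The exponential terms of \<open>Phi\<close> sum to \<open>\<Sum>x y. \<pi> x * T x y * (\<nu> y / \<pi> y)\<close>, which is \<open>1\<close> by
  stationarity.
\<close>

lemma dissipation_eq:
  assumes \<nu>: "law_on X \<nu>" and pos: "\<And>x. x \<in> X \<Longrightarrow> \<nu> x > 0"
  shows "dissipation \<nu> = - (\<Sum>x\<in>X. \<nu> x * (\<Sum>y\<in>X. T x y * (log_density \<nu> y - log_density \<nu> x)))"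
proof -
  let ?g = "log_density \<nu>"
  have exp_g: "\<nu> x * exp (?g y - ?g x) = stat x * (\<nu> y / stat y)" if "x \<in> X" "y \<in> X" for x y
    using pos[OF that(1)] pos[OF that(2)] stat_pos[OF that(1)] stat_pos[OF that(2)]
    by (simp add: log_density_def exp_diff field_simps)
  have "dissipation \<nu> = (\<Sum>x\<in>X. \<Sum>y\<in>X. \<nu> x * T x y * exp (?g y - ?g x) - T x y * \<nu> x
      - \<nu> x * (T x y * (?g y - ?g x)))"
    unfolding dissipation_def Phi_def by (simp add: sum_distrib_left algebra_simps)
  also have "\<dots> = (\<Sum>x\<in>X. \<Sum>y\<in>X. \<nu> x * T x y * exp (?g y - ?g x)) - (\<Sum>x\<in>X. \<Sum>y\<in>X. T x y * \<nu> x)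
      - (\<Sum>x\<in>X. \<nu> x * (\<Sum>y\<in>X. T x y * (?g y - ?g x)))"
    by (simp only: sum_subtractf sum_distrib_left)
  also have "(\<Sum>x\<in>X. \<Sum>y\<in>X. T x y * \<nu> x) = 1"
    using \<nu> by (simp add: T_sum law_on_def flip: sum_distrib_right)
  also have "(\<Sum>x\<in>X. \<Sum>y\<in>X. \<nu> x * T x y * exp (?g y - ?g x))
      = (\<Sum>x\<in>X. \<Sum>y\<in>X. stat x * T x y * (\<nu> y / stat y))"
    using exp_g by (intro sum.cong refl) (simp add: mult.assoc mult.left_commute[of _ "T _ _"])
  also have "\<dots> = (\<Sum>y\<in>X. (\<Sum>x\<in>X. stat x * T x y) * (\<nu> y / stat y))"
    unfolding sum_distrib_right by (rule sum.swap)
  also have "\<dots> = (\<Sum>y\<in>X. \<nu> y)"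
  proof (rule sum.cong)
    fix y assume "y \<in> X"
    then show "(\<Sum>x\<in>X. stat x * T x y) * (\<nu> y / stat y) = \<nu> y"
      using stat_pos[of y] by (simp add: stat_balance)
  qed simp
  also have "\<dots> = 1" using \<nu> by (simp add: law_on_def)
  finally show ?thesis by simp
qed

lemma Ent_deriv:
  assumes \<mu>: "law_on X \<mu>" and t: "t > 0"
  shows "((\<lambda>t. Ent X T (law_at X T \<mu> t)) has_real_derivative - dissipation (law_at X T \<mu> t)) (at t)"
proof -
  let ?m = "\<lambda>t. law_at X T \<mu> t" and ?g = "log_density (law_at X T \<mu> t)"
  let ?D = "\<lambda>y. (\<Sum>x\<in>X. ?m t x * T x y) - ?m t y"
  have m: "law_on X (?m t)" using \<mu> t by (simp add: law_on_law_at)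
  have "((\<lambda>t. ?m t y * ln (?m t y / stat y)) has_real_derivative ?D y * ?g y + ?D y) (at t)"
    if y: "y \<in> X" for y
    using law_at_pos[OF \<mu> t y] stat_pos[OF y]
    by (auto intro!: derivative_eq_intros law_at_deriv y simp: log_density_def)
  then have "((\<lambda>t. Ent X T (?m t)) has_real_derivative (\<Sum>y\<in>X. ?D y * ?g y + ?D y)) (at t)"
    unfolding Ent_def by (intro DERIV_sum)
  also have "(\<Sum>y\<in>X. ?D y * ?g y + ?D y) = - dissipation (?m t)"
  proof -
    have swap: "(\<Sum>y\<in>X. (\<Sum>x\<in>X. ?m t x * T x y) * h y) = (\<Sum>x\<in>X. ?m t x * (\<Sum>y\<in>X. T x y * h y))" for h
      unfolding sum_distrib_left sum_distrib_right mult.assoc by (rule sum.swap)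
    have "(\<Sum>y\<in>X. ?D y) = 0"
      using swap[of "\<lambda>_. 1"] by (simp add: sum_subtractf T_sum)
    moreover have "(\<Sum>y\<in>X. ?D y * ?g y) = (\<Sum>x\<in>X. ?m t x * (\<Sum>y\<in>X. T x y * ?g y)) - (\<Sum>x\<in>X. ?m t x * ?g x)"
      by (simp add: left_diff_distrib sum_subtractf swap)
    moreover have "(\<Sum>x\<in>X. ?m t x * (\<Sum>y\<in>X. T x y * (?g y - ?g x)))
        = (\<Sum>x\<in>X. ?m t x * (\<Sum>y\<in>X. T x y * ?g y)) - (\<Sum>x\<in>X. ?m t x * ?g x)"
      by (simp add: right_diff_distrib sum_subtractf T_sum flip: sum_distrib_right)
    ultimately show ?thesis
      using dissipation_eq[OF m] law_at_pos[OF \<mu> t] by (simp add: sum.distrib)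
  qed
  finally show ?thesis .
qed

lemma continuous_on_Ent:
  assumes \<mu>: "law_on X \<mu>"
  shows "continuous_on {0..} (\<lambda>t. Ent X T (law_at X T \<mu> t))"
  unfolding Ent_def
proof (intro continuous_on_sum)
  fix y assume y: "y \<in> X"
  have "continuous_on {0..} (\<lambda>t. law_at X T \<mu> t y)"
    using law_at_deriv[OF y] DERIV_isCont by (meson continuous_at_imp_continuous_on)
  moreover have "(\<lambda>t. law_at X T \<mu> t y) ` {0..} \<subseteq> {0..}"
    using law_on_law_at[OF \<mu>] y by (auto simp: law_on_def)
  ultimately show "continuous_on {0..} (\<lambda>t. law_at X T \<mu> t y * ln (law_at X T \<mu> t y / stat y))"
    using continuous_on_compose2[OF continuous_on_entropy_integrand[OF stat_pos[OF y]]] by blast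
qed

text \<open>
  Gronwall's inequality: \<open>Ent(X\<^sub>t) exp (t / c)\<close> is non-increasing.
\<close>

lemma Ent_decay:
  assumes \<mu>: "law_on X \<mu>" and t: "t \<ge> 0" and c: "c > 0"
    and mls: "\<And>\<nu>. law_on X \<nu> \<Longrightarrow> (\<And>x. x \<in> X \<Longrightarrow> \<nu> x > 0) \<Longrightarrow> Ent X T \<nu> \<le> c * dissipation \<nu>"
  shows "Ent X T (law_at X T \<mu> t) \<le> Ent X T \<mu> * exp (- t / c)"
proof -
  define F where "F t = Ent X T (law_at X T \<mu> t) * exp (t / c)" for t
  have "F t \<le> F 0"
  proof (rule DERIV_nonpos_imp_decreasing_open[OF t])
    fix s :: real assume s: "0 < s"
    let ?D = "dissipation (law_at X T \<mu> s)"
    have "(F has_real_derivative (- ?D + Ent X T (law_at X T \<mu> s) / c) * exp (s / c)) (at s)"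
      unfolding F_def using c
      by (auto intro!: derivative_eq_intros Ent_deriv[OF \<mu> s] simp: field_simps)
    moreover have "Ent X T (law_at X T \<mu> s) \<le> c * ?D"
      using s by (intro mls law_on_law_at \<mu> law_at_pos) auto
    then have "(- ?D + Ent X T (law_at X T \<mu> s) / c) * exp (s / c) \<le> 0"
      using c by (intro mult_nonpos_nonneg) (auto simp: field_simps)
    ultimately show "\<exists>y. DERIV F s :> y \<and> y \<le> 0" by blast
  next
    show "continuous_on {0..t} F"
      unfolding F_def using c
      by (intro continuous_intros continuous_on_subset[OF continuous_on_Ent[OF \<mu>]]) auto
  qed
  then show ?thesis using law_at_0[OF \<mu>] by (simp add: F_def exp_minus field_simps)
qed

section \<open>The modified log-Sobolev constant\<close>

text \<open>
  With \<open>f = \<nu> / \<pi>\<close>, the term of \<open>dissipation\<close> for the edge \<open>x, y\<close> is \<open>\<pi> x * T x y\<close> times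
  \<open>f x * ln (f x / f y) - f x + f y\<close>.
\<close>

lemma dissipation_ge_sqrt_increment:
  assumes \<nu>: "law_on X \<nu>" and pos: "\<And>x. x \<in> X \<Longrightarrow> \<nu> x > 0" and xy: "x \<in> X" "y \<in> X"
  shows "stat x * T x y * (sqrt (\<nu> x / stat x) - sqrt (\<nu> y / stat y))\<^sup>2 \<le> dissipation \<nu>"
proof -
  let ?g = "log_density \<nu>" and ?f = "\<lambda>x. \<nu> x / stat x"
  have f: "?f z > 0" if "z \<in> X" for z using pos[OF that] stat_pos[OF that] by simp
  have "?f x - ?f y + (sqrt (?f x) - sqrt (?f y))\<^sup>2 \<le> ?f x * ln (?f x / ?f y)"
    by (intro entropy_integrand_ge less_imp_le f xy)
  also have "ln (?f x / ?f y) = ?g x - ?g y"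
    unfolding log_density_def by (intro ln_divide_pos f xy)
  finally have "(sqrt (?f x) - sqrt (?f y))\<^sup>2 \<le> ?f x * (?g x - ?g y) + ?f y - ?f x" by simp
  also have "\<dots> = ?f x * Phi (?g y - ?g x)"
  proof -
    have "?f x * exp (?g y - ?g x) = ?f y"
      using f[OF xy(1)] f[OF xy(2)] pos[OF xy(1)] pos[OF xy(2)] stat_pos[OF xy(1)]
      by (simp add: log_density_def exp_diff)
    then show ?thesis by (simp add: Phi_def right_diff_distrib)
  qed
  finally have "stat x * T x y * (sqrt (?f x) - sqrt (?f y))\<^sup>2 \<le> stat x * T x y * (?f x * Phi (?g y - ?g x))"
    using stat_pos[OF xy(1)] T_nonneg[OF xy] by (intro mult_left_mono) auto
  also have "\<dots> = \<nu> x * (T x y * Phi (?g y - ?g x))"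
    using stat_pos[OF xy(1)] by simp
  also have "\<dots> \<le> \<nu> x * (\<Sum>y\<in>X. T x y * Phi (?g y - ?g x))"
    using pos[OF xy(1)] finite_X xy
    by (intro mult_left_mono member_le_sum) (auto intro!: mult_nonneg_nonneg T_nonneg Phi_nonneg)
  also have "\<dots> \<le> dissipation \<nu>"
    unfolding dissipation_def using finite_X xy less_imp_le[OF pos]
    by (intro member_le_sum[of x X "\<lambda>x. \<nu> x * _ x"])
      (auto intro!: mult_nonneg_nonneg sum_nonneg T_nonneg Phi_nonneg)
  finally show ?thesis .
qed

lemma increment_along_path:
  fixes h :: "'a \<Rightarrow> real"
  assumes edge: "\<And>x y. x \<in> X \<Longrightarrow> y \<in> X \<Longrightarrow> T x y > 0 \<Longrightarrow> \<bar>h x - h y\<bar> \<le> e"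
    and "x \<in> X" "y \<in> X" "pow k x y > 0"
  shows "\<bar>h x - h y\<bar> \<le> real k * e"
  using assms(2-)
proof (induction k arbitrary: x)
  case 0
  then show ?case by (simp split: if_splits)
next
  case (Suc k)
  then have "\<exists>z\<in>X. T x z * pow k z y > 0"
    using sum_nonpos[of X "\<lambda>z. T x z * pow k z y"] by (force simp: not_less)
  then obtain z where z: "z \<in> X" "T x z * pow k z y > 0" by auto
  then have "T x z > 0" "pow k z y > 0"
    using T_nonneg[of x z] pow_nonneg[of z y k] Suc.prems by (auto simp: zero_less_mult_iff)
  then show ?case using Suc.IH[of z] edge[of x z] z Suc.prems by (simp add: algebra_simps)
qed

lemma paths_bounded: "\<exists>K. \<forall>x\<in>X. \<forall>y\<in>X. \<exists>k\<le>K. pow k x y > 0"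
proof -
  obtain \<kappa> where \<kappa>: "\<And>x y. x \<in> X \<Longrightarrow> y \<in> X \<Longrightarrow> pow (\<kappa> x y) x y > 0"
    using irreducible unfolding irreducible_on_def by metis
  have "\<kappa> x y \<le> Max ((\<lambda>(x, y). \<kappa> x y) ` (X \<times> X))" if "x \<in> X" "y \<in> X" for x y
    using finite_X that by (intro Max_ge) auto
  then show ?thesis using \<kappa> by blast
qed

lemma Ent_le_chi_square:
  assumes \<nu>: "law_on X \<nu>" and pos: "\<And>x. x \<in> X \<Longrightarrow> \<nu> x > 0"
  shows "Ent X T \<nu> \<le> (\<Sum>x\<in>X. stat x * (\<nu> x / stat x - 1)\<^sup>2)"
proof -
  have "Ent X T \<nu> \<le> (\<Sum>x\<in>X. \<nu> x * (\<nu> x / stat x - 1))"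
    unfolding Ent_def using pos stat_pos
    by (intro sum_mono mult_left_mono ln_le_minus_one) (auto intro: less_imp_le)
  also have "\<dots> = (\<Sum>x\<in>X. stat x * (\<nu> x / stat x - 1)\<^sup>2 + (\<nu> x - stat x))"
  proof (rule sum.cong)
    fix x assume "x \<in> X"
    then show "\<nu> x * (\<nu> x / stat x - 1) = stat x * (\<nu> x / stat x - 1)\<^sup>2 + (\<nu> x - stat x)"
      using stat_pos[of x] by (simp add: power2_eq_square field_simps)
  qed simp
  also have "\<dots> = (\<Sum>x\<in>X. stat x * (\<nu> x / stat x - 1)\<^sup>2)"
    using \<nu> by (simp add: sum.distrib sum_subtractf stat_sum law_on_def)
  finally show ?thesis .
qed

text \<open>
  If the dissipation is small, \<open>sqrt (\<nu> / \<pi>)\<close> varies little along every edge, hence along every path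
  of bounded length, hence \<open>\<nu> / \<pi>\<close> is uniformly close to \<open>1\<close>, and the entropy is at most the
  chi-square distance. The constant is very poor, but its mere existence gives \<open>t_mls\<close> a meaning,
  as the infimum of the empty set would be an arbitrary number.
\<close>

lemma modified_log_sobolev:
  "\<exists>c>0. \<forall>\<nu>. law_on X \<nu> \<and> (\<forall>x\<in>X. \<nu> x > 0) \<longrightarrow> Ent X T \<nu> \<le> c * dissipation \<nu>"
proof -
  obtain K where K: "\<And>x y. x \<in> X \<Longrightarrow> y \<in> X \<Longrightarrow> \<exists>k\<le>K. pow k x y > 0"
    using paths_bounded by blast
  define \<beta> where "\<beta> = Min (insert 1 {stat x * T x y | x y. x \<in> X \<and> y \<in> X \<and> T x y > 0})"
  define \<sigma> where "\<sigma> = Min (stat ` X)"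
  have fin: "finite {stat x * T x y | x y. x \<in> X \<and> y \<in> X \<and> T x y > 0}"
    by (rule finite_subset[of _ "(\<lambda>(x, y). stat x * T x y) ` (X \<times> X)"]) (use finite_X in auto)
  have \<beta>_le: "\<beta> \<le> stat x * T x y" if "x \<in> X" "y \<in> X" "T x y > 0" for x y
    unfolding \<beta>_def using fin that by (intro Min_le) auto
  have \<beta>: "\<beta> > 0" unfolding \<beta>_def using fin stat_pos by (subst Min_gr_iff) auto
  have \<sigma>: "\<sigma> > 0" unfolding \<sigma>_def using finite_X X_ne stat_pos by (subst Min_gr_iff) auto
  have \<sigma>_le: "\<sigma> \<le> stat x" if "x \<in> X" for x
    unfolding \<sigma>_def using finite_X that by auto
  define c where "c = 4 * (real K)\<^sup>2 / (\<sigma> * \<beta>)"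
  have "Ent X T \<nu> \<le> c * dissipation \<nu>" if \<nu>: "law_on X \<nu>" and pos: "\<And>x. x \<in> X \<Longrightarrow> \<nu> x > 0" for \<nu>
  proof -
    let ?f = "\<lambda>x. \<nu> x / stat x"
    define e where "e = sqrt (dissipation \<nu> / \<beta>)"
    have e: "e \<ge> 0" "e\<^sup>2 = dissipation \<nu> / \<beta>"
      using dissipation_nonneg[OF \<nu>] \<beta> by (auto simp: e_def)
    have edge: "\<bar>sqrt (?f x) - sqrt (?f y)\<bar> \<le> e" if xy: "x \<in> X" "y \<in> X" "T x y > 0" for x y
    proof -
      have "\<beta> * (sqrt (?f x) - sqrt (?f y))\<^sup>2 \<le> stat x * T x y * (sqrt (?f x) - sqrt (?f y))\<^sup>2"
        using \<beta>_le[OF xy] by (intro mult_right_mono) auto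
      also have "\<dots> \<le> dissipation \<nu>" by (rule dissipation_ge_sqrt_increment[OF \<nu> pos xy(1,2)])
      finally show ?thesis
        unfolding e_def using \<beta> by (intro real_le_rsqrt) (simp add: field_simps)
    qed
    have f: "0 \<le> ?f x" "?f x \<le> 1 / \<sigma>" if x: "x \<in> X" for x
    proof -
      have "\<nu> x \<le> 1" using member_le_sum[of x X \<nu>] \<nu> x finite_X by (auto simp: law_on_def)
      then show "?f x \<le> 1 / \<sigma>" using \<sigma>_le[OF x] \<sigma> pos[OF x] by (intro frac_le) auto
      show "0 \<le> ?f x" using pos[OF x] stat_pos[OF x] by simp
    qed
    have diff: "\<bar>?f x - ?f y\<bar> \<le> (real K * e) * (2 * sqrt (1 / \<sigma>))" if xy: "x \<in> X" "y \<in> X" for x y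
    proof -
      obtain k where k: "k \<le> K" "pow k x y > 0" using K[OF xy] by auto
      have "\<bar>?f x - ?f y\<bar> = \<bar>sqrt (?f x) - sqrt (?f y)\<bar> * (sqrt (?f x) + sqrt (?f y))"
        by (rule abs_diff_eq_sqrt) (use f xy in auto)
      also have "\<dots> \<le> (real K * e) * (2 * sqrt (1 / \<sigma>))"
      proof (intro mult_mono)
        have "\<bar>sqrt (?f x) - sqrt (?f y)\<bar> \<le> real k * e"
          by (rule increment_along_path[OF edge xy k(2)])
        also have "\<dots> \<le> real K * e" using k e by (intro mult_right_mono) auto
        finally show "\<bar>sqrt (?f x) - sqrt (?f y)\<bar> \<le> real K * e" .
        have "sqrt (?f x) \<le> sqrt (1 / \<sigma>)" "sqrt (?f y) \<le> sqrt (1 / \<sigma>)"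
          using f xy by (auto intro!: real_sqrt_le_mono simp del: real_sqrt_divide)
        then show "sqrt (?f x) + sqrt (?f y) \<le> 2 * sqrt (1 / \<sigma>)" by linarith
      qed (use e f[OF xy(1)] f[OF xy(2)] in auto)
      finally show ?thesis .
    qed
    have "(?f x - 1)\<^sup>2 \<le> c * dissipation \<nu>" if x: "x \<in> X" for x
    proof -
      have "?f x - 1 = (\<Sum>y\<in>X. stat y * (?f x - ?f y))"
      proof -
        have "(\<Sum>y\<in>X. stat y * ?f y) = (\<Sum>y\<in>X. \<nu> y)"
          using stat_pos by (intro sum.cong) force+
        then show ?thesis using \<nu> stat_sum
          by (simp add: right_diff_distrib sum_subtractf law_on_def flip: sum_distrib_right sum_divide_distrib)
      qed
      also have "\<bar>\<dots>\<bar> \<le> (\<Sum>y\<in>X. stat y * ((real K * e) * (2 * sqrt (1 / \<sigma>))))"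
        by (rule order.trans[OF sum_abs sum_mono])
          (use diff[OF x] stat_pos in \<open>auto simp: abs_mult abs_of_pos mult.assoc intro!: mult_left_mono\<close>)
      also have "\<dots> = (real K * e) * (2 * sqrt (1 / \<sigma>))"
        using stat_sum by (simp flip: sum_distrib_right)
      finally have "(?f x - 1)\<^sup>2 \<le> ((real K * e) * (2 * sqrt (1 / \<sigma>)))\<^sup>2"
        by (rule abs_le_square_iff[THEN iffD1, OF order.trans]) simp
      also have "\<dots> = c * dissipation \<nu>"
        using \<sigma> \<beta> e(2) by (simp add: power_mult_distrib c_def power_divide real_sqrt_divide mult_ac)
      finally show ?thesis .
    qed
    then have "(\<Sum>x\<in>X. stat x * (?f x - 1)\<^sup>2) \<le> (\<Sum>x\<in>X. stat x * (c * dissipation \<nu>))"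
      using less_imp_le[OF stat_pos] by (intro sum_mono mult_left_mono) auto
    also have "\<dots> = c * dissipation \<nu>" using stat_sum by (simp flip: sum_distrib_right)
    finally show ?thesis using Ent_le_chi_square[OF \<nu> pos] by simp
  qed
  moreover have "c * dissipation \<nu> \<le> (c + 1) * dissipation \<nu>" if "law_on X \<nu>" for \<nu>
    using dissipation_nonneg[OF that] by (simp add: algebra_simps)
  moreover have "c + 1 > 0" using \<sigma> \<beta> by (simp add: c_def add_nonneg_pos)
  ultimately show ?thesis by (meson order.trans)
qed

definition mls_constants :: "real set" where
  "mls_constants = {c. c > 0 \<and> (\<forall>\<mu>. law_on X \<mu> \<longrightarrow>
     (\<forall>t\<ge>0. Ent X T (law_at X T \<mu> t) \<le> Ent X T \<mu> * exp (- t / c)))}"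

lemma t_mls_eq: "t_mls X T = Inf mls_constants"
  by (simp add: t_mls_def mls_constants_def)

lemma mls_constantsD:
  assumes "c \<in> mls_constants" "law_on X \<mu>" "t \<ge> 0"
  shows "Ent X T (law_at X T \<mu> t) \<le> Ent X T \<mu> * exp (- t / c)"
  using assms unfolding mls_constants_def by blast

lemma mls_constants_ne: "mls_constants \<noteq> {}"
proof -
  obtain c where "c > 0" "\<And>\<nu>. law_on X \<nu> \<Longrightarrow> (\<And>x. x \<in> X \<Longrightarrow> \<nu> x > 0) \<Longrightarrow> Ent X T \<nu> \<le> c * dissipation \<nu>"
    using modified_log_sobolev by blast
  then have "c \<in> mls_constants"
    unfolding mls_constants_def using Ent_decay by blast
  then show ?thesis by auto
qed

text \<open>
  Starting from a state of stationary weight at most \<open>1 / 2\<close>, no jump has occurred by time \<open>\<tau> = 1 / 64\<close>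
  with probability at least \<open>63 / 64\<close>, so the entropy has not had the time to drop by a factor \<open>e\<close>.
  Thus \<open>t_mls\<close> absorbs every constant time in the estimates of mixing times.
\<close>

lemma mls_constant_ge:
  assumes card: "card X \<ge> 2" and c: "c \<in> mls_constants"
  shows "1 / 64 \<le> c"
proof -
  have "\<exists>o'\<in>X. stat o' \<le> 1 / 2"
  proof -
    obtain a b where ab: "a \<in> X" "b \<in> X" "a \<noteq> b"
      using card finite_X by (metis card_2_iff' card_le_Suc0_iff_eq not_less_eq_eq numeral_2_eq_2)
    have "(\<Sum>x\<in>{a, b}. stat x) \<le> (\<Sum>x\<in>X. stat x)"
      using ab finite_X stat_pos by (intro sum_mono2) (auto intro: less_imp_le)
    then have "stat a \<le> 1 / 2 \<or> stat b \<le> 1 / 2" using ab stat_sum by auto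
    then show ?thesis using ab by blast
  qed
  then obtain o' where o': "o' \<in> X" "stat o' \<le> 1 / 2" by auto
  define \<tau> :: real where "\<tau> = 1 / 64"
  define m where "m = law_at X T (\<lambda>x. of_bool (x = o')) \<tau>"
  define q where "q = (\<Sum>x\<in>X - {o'}. m x)"
  define h where "h = ln (1 / stat o')"
  have law: "law_on X m"
    unfolding m_def using o' by (intro law_on_law_at law_on_point_mass) (auto simp: \<tau>_def)
  have m_pos: "m x > 0" if "x \<in> X" for x
    unfolding m_def using that o' by (intro law_at_pos law_on_point_mass) (auto simp: \<tau>_def)
  have Ent0: "Ent X T (\<lambda>x. of_bool (x = o')) = h"
    unfolding Ent_def h_def using o' finite_X sum_point_mass(2)[of X o' "\<lambda>x. ln (of_bool (x = o') / stat x)"]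
    by simp
  have h: "h \<ge> 2 / 3"
  proof -
    have "ln 2 \<le> h" unfolding h_def using o' stat_pos[OF o'(1)] by (simp add: field_simps)
    then show ?thesis using ln2_ge_two_thirds by simp
  qed
  have m_o: "m o' = 1 - q"
    using law o' finite_X by (simp add: q_def law_on_def sum.remove)
  have "X - {o'} \<noteq> {}"
    using card o' finite_X by (metis One_nat_def Suc_1 card.empty card_Diff_singleton diff_is_0_eq not_less_eq_eq)
  then have q_pos: "q > 0"
    unfolding q_def using m_pos finite_X by (intro sum_pos) auto
  have p_ge: "1 - q \<ge> 63 / 64"
  proof -
    have "m o' \<ge> exp (- \<tau>)" using o' kernel_diag_ge[of \<tau> o'] by (simp add: m_def law_at_point_mass \<tau>_def)
    then show ?thesis using exp_ge_add_one_self[of "- \<tau>"] m_o by (simp add: \<tau>_def)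
  qed
  \<comment> \<open>The entropy is bounded below by that of the image of \<open>m\<close> under the indicator of the state \<open>o'\<close>:
      the states other than \<open>o'\<close> contribute at least \<open>q * ln q\<close>.\<close>
  have "Ent X T m = m o' * ln (m o' / stat o') + (\<Sum>x\<in>X - {o'}. m x * ln (m x / stat x))"
    unfolding Ent_def using o' finite_X by (simp add: sum.remove)
  moreover have "m o' * ln (m o' / stat o') \<ge> 63 / 64 * h - 1 / 64"
  proof -
    have p: "m o' > 0" using m_pos o' by simp
    have "m o' * ln (m o' / stat o') = m o' * ln (m o') + m o' * h"
      using p stat_pos[OF o'(1)] by (simp add: h_def ln_div algebra_simps)
    moreover have "m o' * ln (m o') \<ge> m o' - 1"
      using entropy_integrand_ge[of "m o'" 1] p by (smt (verit) div_by_1 zero_le_power2)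
    moreover have "m o' * h \<ge> 63 / 64 * h" using p_ge m_o h by (intro mult_right_mono) auto
    ultimately show ?thesis using p_ge m_o by simp
  qed
  moreover have "(\<Sum>x\<in>X - {o'}. m x * ln (m x / stat x)) \<ge> q * ln q"
  proof -
    have "(\<Sum>x\<in>X - {o'}. m x - q * stat x + m x * ln q) \<le> (\<Sum>x\<in>X - {o'}. m x * ln (m x / stat x))"
    proof (rule sum_mono)
      fix x assume "x \<in> X - {o'}"
      then have x: "m x > 0" "stat x > 0" using m_pos stat_pos by auto
      have "m x - q * stat x \<le> m x * ln (m x / (q * stat x))"
        using entropy_integrand_ge[of "m x" "q * stat x"] x q_pos
        by (smt (verit) mult_pos_pos zero_le_power2)
      also have "\<dots> = m x * ln (m x / stat x) - m x * ln q"
        using x q_pos by (simp add: ln_div ln_mult algebra_simps)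
      finally show "m x - q * stat x + m x * ln q \<le> m x * ln (m x / stat x)" by simp
    qed
    moreover have "(\<Sum>x\<in>X - {o'}. m x - q * stat x + m x * ln q) = q - q * (1 - stat o') + q * ln q"
      using o' finite_X stat_sum sum.remove[OF finite_X o'(1), of stat]
      by (simp add: sum.distrib sum_subtractf q_def flip: sum_distrib_left sum_distrib_right)
    moreover have "q - q * (1 - stat o') \<ge> 0"
      using q_pos stat_pos[OF o'(1)] by (simp add: algebra_simps)
    ultimately show ?thesis by simp
  qed
  moreover have "q * ln q \<ge> - 1 / 4"
  proof -
    have "\<bar>q * ln (q / 1)\<bar> \<le> 2 * sqrt (1 * q)"
      using q_pos p_ge by (intro entropy_integrand_small) auto
    moreover have "sqrt q \<le> sqrt ((1 / 8)\<^sup>2)"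
      using p_ge by (intro real_sqrt_le_mono) (simp add: power2_eq_square)
    ultimately show ?thesis by simp
  qed
  ultimately have "Ent X T m \<ge> 63 / 64 * h - 17 / 64" by simp
  also have "63 / 64 * h - 17 / 64 \<ge> 31 / 64 * h" using h by simp
  also have "Ent X T m \<le> Ent X T (\<lambda>x. of_bool (x = o')) * exp (- \<tau> / c)"
    unfolding m_def by (intro mls_constantsD c law_on_point_mass o'(1)) (simp add: \<tau>_def)
  finally have "31 / 64 * h \<le> h * exp (- \<tau> / c)" by (simp add: Ent0)
  then have "31 / 64 \<le> exp (- \<tau> / c)" using h by simp
  moreover have "exp (- 1) < (31 / 64 :: real)"
    using exp_lower_Taylor_quadratic[of 1] by (simp add: exp_minus field_simps)
  ultimately have "exp (- 1) < exp (- \<tau> / c)" by (meson less_le_trans)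
  then show ?thesis using c by (simp add: \<tau>_def mls_constants_def field_simps)
qed

lemma t_mls_ge: "card X \<ge> 2 \<Longrightarrow> 1 / 64 \<le> t_mls X T"
  unfolding t_mls_eq using mls_constants_ne mls_constant_ge by (intro cInf_greatest) auto

text \<open>
  The factor \<open>2\<close> makes room for an admissible constant above the infimum; it changes nothing up to
  constants.
\<close>

lemma Ent_decay_t_mls:
  assumes \<mu>: "law_on X \<mu>" and t: "t \<ge> 0" and pos: "t_mls X T > 0"
  shows "Ent X T (law_at X T \<mu> t) \<le> Ent X T \<mu> * exp (- t / (2 * t_mls X T))"
proof -
  have "Inf mls_constants < 2 * t_mls X T" using pos t_mls_eq by simp
  then obtain c where c: "c \<in> mls_constants" "c < 2 * t_mls X T"
    using mls_constants_ne by (meson cInf_lessD)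
  then have "c > 0" by (simp add: mls_constants_def)
  have "Ent X T (law_at X T \<mu> t) \<le> Ent X T \<mu> * exp (- t / c)"
    using c \<mu> t by (intro mls_constantsD)
  also have "\<dots> \<le> Ent X T \<mu> * exp (- t / (2 * t_mls X T))"
    using c \<open>c > 0\<close> t Ent_nonneg[OF \<mu>]
    by (intro mult_left_mono) (auto simp: divide_left_mono)
  finally show ?thesis .
qed

end

section \<open>Variance under non-negative curvature\<close>

context finite_chain
begin

text \<open>
  The derivative in \<open>s\<close> of \<open>P\<^sub>s ((P\<^bsub>t-s\<^esub> g)\<^sup>2)\<close>, which interpolates between the two terms of the
  variance, is \<open>2 P\<^sub>s (\<Gamma> (P\<^bsub>t-s\<^esub> g))\<close>. By non-negative curvature it is at most
  \<open>2 P\<^sub>s P\<^bsub>t-s\<^esub> (\<Gamma> g) = 2 P\<^sub>t (\<Gamma> g)\<close>, and \<open>2 \<Gamma> g x\<close> is the inner sum on the right-hand side.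
\<close>

lemma local_poincare:
  assumes curv: "nonneg_curved X T" and t: "t \<ge> 0" and o': "o' \<in> X"
  shows "(\<Sum>y\<in>X. kernel t o' y * (g y)\<^sup>2) - (\<Sum>y\<in>X. kernel t o' y * g y)\<^sup>2
    \<le> t * (\<Sum>x\<in>X. kernel t o' x * (\<Sum>y\<in>X. T x y * (g y - g x)\<^sup>2))"
proof -
  define G where "G r x = (\<Sum>z\<in>X. kernel r x z * g z)" for r x
  define h where "h s = (\<Sum>y\<in>X. kernel s o' y * (G (t - s) y)\<^sup>2)" for s
  define M where "M = (\<Sum>x\<in>X. kernel t o' x * (\<Sum>y\<in>X. T x y * (g y - g x)\<^sup>2))"
  have Gd: "((\<lambda>s. G (t - s) x) has_real_derivative - ((\<Sum>y\<in>X. T x y * G (t - s) y) - G (t - s) x)) (at s)"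
    if x: "x \<in> X" for s x
  proof -
    have "(G' has_real_derivative (\<Sum>z\<in>X. ((\<Sum>y\<in>X. T x y * kernel r y z) - kernel r x z) * g z)) (at r)"
      if "G' = (\<lambda>r. G r x)" for r G'
      unfolding that G_def by (intro DERIV_sum DERIV_cmult_right kernel_backward x)
    moreover have "(\<Sum>z\<in>X. (\<Sum>y\<in>X. T x y * kernel r y z) * g z) = (\<Sum>y\<in>X. T x y * G r y)" for r
      unfolding G_def sum_distrib_left sum_distrib_right mult.assoc by (rule sum.swap)
    ultimately have d: "((\<lambda>r. G r x) has_real_derivative (\<Sum>y\<in>X. T x y * G r y) - G r x) (at r)" for r
      by (simp add: left_diff_distrib sum_subtractf G_def)
    have "((\<lambda>s. t - s) has_real_derivative - 1) (at s)"
      by (auto intro!: derivative_eq_intros)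
    from DERIV_chain2[where f = "\<lambda>r. G r x" and g = "\<lambda>s. t - s" and x = s and s = UNIV,
        OF d[of "t - s"] this] show ?thesis by simp
  qed
  have hd: "(h has_real_derivative
      (\<Sum>x\<in>X. kernel s o' x * (\<Sum>y\<in>X. T x y * (G (t - s) y - G (t - s) x)\<^sup>2))) (at s)" for s
  proof -
    let ?G = "G (t - s)"
    have "(h has_real_derivative (\<Sum>y\<in>X. ((\<Sum>z\<in>X. kernel s o' z * T z y) - kernel s o' y) * (?G y)\<^sup>2
        + (2 * ?G y * - ((\<Sum>z\<in>X. T y z * ?G z) - ?G y)) * kernel s o' y)) (at s)"
      unfolding h_def
      by (intro DERIV_sum DERIV_mult kernel_forward o')
        (auto intro!: derivative_eq_intros Gd)
    also have "(\<Sum>y\<in>X. ((\<Sum>z\<in>X. kernel s o' z * T z y) - kernel s o' y) * (?G y)\<^sup>2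
        + (2 * ?G y * - ((\<Sum>z\<in>X. T y z * ?G z) - ?G y)) * kernel s o' y)
      = (\<Sum>y\<in>X. (\<Sum>z\<in>X. kernel s o' z * T z y) * (?G y)\<^sup>2)
        + (\<Sum>x\<in>X. kernel s o' x * ((?G x)\<^sup>2 - 2 * ?G x * (\<Sum>z\<in>X. T x z * ?G z)))"
      unfolding sum.distrib[symmetric] by (intro sum.cong) (auto simp: algebra_simps power2_eq_square)
    also have "(\<Sum>y\<in>X. (\<Sum>z\<in>X. kernel s o' z * T z y) * (?G y)\<^sup>2)
        = (\<Sum>x\<in>X. kernel s o' x * (\<Sum>y\<in>X. T x y * (?G y)\<^sup>2))"
      unfolding sum_distrib_left sum_distrib_right mult.assoc by (rule sum.swap)
    also have "\<dots> + (\<Sum>x\<in>X. kernel s o' x * ((?G x)\<^sup>2 - 2 * ?G x * (\<Sum>z\<in>X. T x z * ?G z)))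
        = (\<Sum>x\<in>X. kernel s o' x * (\<Sum>y\<in>X. T x y * (?G y - ?G x)\<^sup>2))"
      unfolding sum.distrib[symmetric]
    proof (intro sum.cong refl)
      fix x assume x: "x \<in> X"
      have "(\<Sum>y\<in>X. T x y * (?G y - ?G x)\<^sup>2)
          = (\<Sum>y\<in>X. T x y * (?G y)\<^sup>2 - 2 * ?G x * (T x y * ?G y) + T x y * (?G x)\<^sup>2)"
        by (intro sum.cong) (auto simp: power2_diff algebra_simps)
      also have "\<dots> = (\<Sum>y\<in>X. T x y * (?G y)\<^sup>2) - 2 * ?G x * (\<Sum>y\<in>X. T x y * ?G y) + (?G x)\<^sup>2"
        using T_sum[OF x] by (simp add: sum.distrib sum_subtractf flip: sum_distrib_left sum_distrib_right)
      finally have sq: "(\<Sum>y\<in>X. T x y * (?G y - ?G x)\<^sup>2)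
          = (\<Sum>y\<in>X. T x y * (?G y)\<^sup>2) - 2 * ?G x * (\<Sum>y\<in>X. T x y * ?G y) + (?G x)\<^sup>2" .
      show "kernel s o' x * (\<Sum>y\<in>X. T x y * (?G y)\<^sup>2)
          + kernel s o' x * ((?G x)\<^sup>2 - 2 * ?G x * (\<Sum>z\<in>X. T x z * ?G z))
        = kernel s o' x * (\<Sum>y\<in>X. T x y * (?G y - ?G x)\<^sup>2)"
        unfolding sq by (simp add: algebra_simps)
    qed
    finally show ?thesis .
  qed
  have h_le: "(\<Sum>x\<in>X. kernel s o' x * (\<Sum>y\<in>X. T x y * (G (t - s) y - G (t - s) x)\<^sup>2)) \<le> M"
    if s: "0 \<le> s" "s \<le> t" for s
  proof -
    let ?\<Gamma> = "\<lambda>x. \<Sum>y\<in>X. T x y * (g y - g x)\<^sup>2"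
    have le: "(\<Sum>y\<in>X. T x y * (G (t - s) y - G (t - s) x)\<^sup>2) \<le> (\<Sum>z\<in>X. kernel (t - s) x z * ?\<Gamma> z)"
      if x: "x \<in> X" for x
    proof -
      have "carre_du_champ X T (heat_semigroup X T (t - s) g) x \<le> heat_semigroup X T (t - s) (carre_du_champ X T g) x"
        using curv s x by (simp add: nonneg_curved_def)
      moreover have "carre_du_champ X T (heat_semigroup X T (t - s) g) x
          = 1 / 2 * (\<Sum>y\<in>X. T x y * (G (t - s) y - G (t - s) x)\<^sup>2)"
        using x by (simp add: carre_du_champ_def heat_semigroup_eq G_def)
      moreover have "heat_semigroup X T (t - s) (carre_du_champ X T g) x
          = 1 / 2 * (\<Sum>z\<in>X. kernel (t - s) x z * ?\<Gamma> z)"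
        unfolding heat_semigroup_eq[OF x] carre_du_champ_def
          sum_distrib_left[of "1 / 2" "\<lambda>z. kernel (t - s) x z * ?\<Gamma> z"]
        by (intro sum.cong refl mult.left_commute)
      ultimately show ?thesis by simp
    qed
    have "(\<Sum>x\<in>X. kernel s o' x * (\<Sum>y\<in>X. T x y * (G (t - s) y - G (t - s) x)\<^sup>2))
        \<le> (\<Sum>x\<in>X. kernel s o' x * (\<Sum>z\<in>X. kernel (t - s) x z * ?\<Gamma> z))"
    proof (rule sum_mono)
      fix x assume x: "x \<in> X"
      show "kernel s o' x * (\<Sum>y\<in>X. T x y * (G (t - s) y - G (t - s) x)\<^sup>2)
          \<le> kernel s o' x * (\<Sum>z\<in>X. kernel (t - s) x z * ?\<Gamma> z)"
        by (rule mult_left_mono[OF le[OF x] kernel_nonneg[OF s(1) o' x]])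
    qed
    also have "\<dots> = (\<Sum>z\<in>X. (\<Sum>x\<in>X. kernel s o' x * kernel (t - s) x z) * ?\<Gamma> z)"
      by (simp only: sum_distrib_left[of "kernel s o' _"] sum_distrib_right mult.assoc) (rule sum.swap)
    also have "\<dots> = M"
      unfolding M_def using kernel_semigroup[OF o', of _ s "t - s"] by (intro sum.cong) auto
    finally show ?thesis .
  qed
  have "h t - t * M \<le> h 0 - 0 * M"
  proof (rule DERIV_nonpos_imp_nonincreasing[OF t])
    fix s assume s: "0 \<le> s" "s \<le> t"
    show "\<exists>y. ((\<lambda>s. h s - s * M) has_real_derivative y) (at s) \<and> y \<le> 0"
      by (rule exI conjI DERIV_diff hd DERIV_cmult_Id[unfolded mult.commute[of M]])+ 
        (use h_le[OF s] in \<open>auto intro!: derivative_eq_intros\<close>)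
  qed
  moreover have "h 0 = (\<Sum>y\<in>X. kernel t o' y * g y)\<^sup>2"
    unfolding h_def sum_kernel_0[OF o'] by (simp add: G_def)
  moreover have "h t = (\<Sum>y\<in>X. kernel t o' y * (g y)\<^sup>2)"
    unfolding h_def by (intro sum.cong refl) (simp add: G_def sum_kernel_0 del: kernel_0)
  ultimately show ?thesis by (simp add: M_def)
qed

end

section \<open>Comparing the heat kernel at neighbouring states\<close>

lemma quadratic_nonneg_imp:
  fixes A C F :: real
  assumes "\<And>b. 0 \<le> A - 2 * b * C + b\<^sup>2 * F" "0 \<le> F"
  shows "C\<^sup>2 \<le> A * F"
proof (cases "F = 0")
  case True
  have "C = 0"
  proof (rule ccontr)
    assume "C \<noteq> 0"
    then show False using assms(1)[of "(A + 1) / (2 * C)"] True by simp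
  qed
  then show ?thesis using True by simp
next
  case False
  then have F: "F > 0" using assms by simp
  have "0 \<le> (A - 2 * (C / F) * C + (C / F)\<^sup>2 * F) * F"
    using assms(1)[of "C / F"] F by (intro mult_nonneg_nonneg) auto
  also have "\<dots> = A * F - C\<^sup>2"
    using F by (simp add: field_simps power2_eq_square)
  finally show ?thesis by simp
qed

lemma sums_egf:
  assumes "\<And>k. \<bar>u k\<bar> \<le> B * b ^ k"
  shows "(\<lambda>k. t ^ k / fact k * u k) sums egf u t"
  unfolding egf_def by (intro summable_sums summable_egf[OF assms])

lemma sums_egf_times_index:
  assumes "\<And>k. \<bar>u k\<bar> \<le> B * b ^ k" "0 \<le> b"
  shows "(\<lambda>k. t ^ k / fact k * (real k * u k)) sums (t * egf (\<lambda>k. u (Suc k)) t)"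
proof -
  have "\<bar>u (Suc k)\<bar> \<le> (B * b) * b ^ k" for k using assms(1)[of "Suc k"] by (simp add: mult_ac)
  from sums_mult[OF sums_egf[OF this], of t t]
  have "(\<lambda>k. t ^ Suc k / fact (Suc k) * (real (Suc k) * u (Suc k))) sums (t * egf (\<lambda>k. u (Suc k)) t)"
    by (simp add: field_simps del: of_nat_Suc)
  from sums_Suc[OF this] show ?thesis by simp
qed

text \<open>
  This is the Cauchy-Schwarz inequality \<open>(\<Sum>k. a\<^sub>k * k)\<^sup>2 \<le> (\<Sum>k. a\<^sub>k * k\<^sup>2) * (\<Sum>k. a\<^sub>k)\<close> for the weights
  \<open>a\<^sub>k = t\<^sup>k / k! * u\<^sub>k\<close>, because a factor \<open>k\<close> in front of \<open>t\<^sup>k / k!\<close> becomes \<open>t\<close> times a shift of \<open>u\<close>. It is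
  used twice, once to bound a conditional variance and once to bound a conditional mean of
  \<open>1 / (N + 1)\<close> from below, where \<open>N\<close> is the Poisson number of jumps.
\<close>

lemma egf_cauchy_schwarz:
  fixes u :: "nat \<Rightarrow> real"
  assumes bound: "\<And>k. \<bar>u k\<bar> \<le> 1" and nonneg: "\<And>k. 0 \<le> u k" and t: "t > 0"
  shows "(egf (\<lambda>k. u (Suc k)) t)\<^sup>2 \<le> (egf (\<lambda>k. u (Suc (Suc k))) t + egf (\<lambda>k. u (Suc k)) t / t) * egf u t"
proof (rule quadratic_nonneg_imp)
  let ?F = "egf u t" and ?F1 = "egf (\<lambda>k. u (Suc k)) t" and ?F2 = "egf (\<lambda>k. u (Suc (Suc k))) t"
  have b1: "\<bar>u k\<bar> \<le> 1 * 1 ^ k" for k using bound by simp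
  have b2: "\<bar>u (Suc k)\<bar> \<le> 1 * 1 ^ k" for k using bound by simp
  have b3: "\<bar>real k * u k\<bar> \<le> 1 * 2 ^ k" for k
  proof -
    have "\<bar>real k * u k\<bar> \<le> real k * 1" unfolding abs_mult using bound by (intro mult_mono) auto
    also have "real k \<le> 2 ^ k" using less_exp[of k] by (metis less_imp_le of_nat_le_iff of_nat_numeral of_nat_power)
    finally show ?thesis by simp
  qed
  have s0: "(\<lambda>k. t ^ k / fact k * u k) sums ?F" by (rule sums_egf[OF b1])
  have s1: "(\<lambda>k. t ^ k / fact k * (real k * u k)) sums (t * ?F1)"
    by (rule sums_egf_times_index[OF b1]) simp
  have "egf (\<lambda>k. real (Suc k) * u (Suc k)) t = t * ?F2 + ?F1"
  proof -
    have "(\<lambda>k. t ^ k / fact k * (real k * u (Suc k)) + t ^ k / fact k * u (Suc k)) sums (t * ?F2 + ?F1)"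
      by (intro sums_add sums_egf_times_index[OF b2] sums_egf[OF b2]) simp
    moreover have "t ^ k / fact k * (real k * u (Suc k)) + t ^ k / fact k * u (Suc k)
        = t ^ k / fact k * (real (Suc k) * u (Suc k))" for k by (simp add: distrib_left distrib_right)
    ultimately show ?thesis unfolding egf_def[of "\<lambda>k. real (Suc k) * u (Suc k)"]
      by (intro sums_unique[symmetric]) (simp only:)
  qed
  with sums_egf_times_index[OF b3, of t]
  have s2: "(\<lambda>k. t ^ k / fact k * (real k * (real k * u k))) sums (t * (t * ?F2 + ?F1))" by simp
  fix b :: real
  have sq_sums: "(\<lambda>k. t ^ k / fact k * (real k * (real k * u k)) / t\<^sup>2 - 2 * b * (t ^ k / fact k * (real k * u k) / t)
      + b\<^sup>2 * (t ^ k / fact k * u k)) sums (t * (t * ?F2 + ?F1) / t\<^sup>2 - 2 * b * (t * ?F1 / t) + b\<^sup>2 * ?F)"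
    by (intro sums_add sums_diff sums_mult sums_divide s0 s1 s2)
  have square: "a * (n * (n * v)) / t\<^sup>2 - 2 * b * (a * (n * v) / t) + b\<^sup>2 * (a * v)
      = a * v * (n / t - b)\<^sup>2" for a n v :: real
    using t by (simp add: power2_eq_square field_simps)
  have sq_nonneg: "0 \<le> t ^ k / fact k * (real k * (real k * u k)) / t\<^sup>2 - 2 * b * (t ^ k / fact k * (real k * u k) / t)
      + b\<^sup>2 * (t ^ k / fact k * u k)" for k
    unfolding square using nonneg t by simp
  have le: "0 \<le> t * (t * ?F2 + ?F1) / t\<^sup>2 - 2 * b * (t * ?F1 / t) + b\<^sup>2 * ?F"
    by (rule sums_le[OF sq_nonneg sums_zero sq_sums])
  have "t * (t * a + c) / t\<^sup>2 - 2 * b * (t * c / t) = a + c / t - 2 * b * c" for a c :: real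
    using t by (simp add: power2_eq_square field_simps)
  from le[unfolded this] show "0 \<le> ?F2 + ?F1 / t - 2 * b * ?F1 + b\<^sup>2 * ?F" .
next
  show "0 \<le> egf u t"
    unfolding egf_def using nonneg t
    by (intro suminf_nonneg summable_egf[of u 1 1]) (use bound in auto)
qed

context finite_chain
begin

text \<open>
  By the Poisson identity \<open>k t\<^sup>k / k! = t t\<^bsup>k-1\<^esup> / (k-1)!\<close> this is the conditional expectation of
  \<open>N / t\<close> given \<open>X\<^sub>t = x\<close>, where \<open>N\<close> is the number of jumps up to time \<open>t\<close>, for the chain started at \<open>o'\<close>.
\<close>

definition kernel_ratio :: "real \<Rightarrow> 'a \<Rightarrow> 'a \<Rightarrow> real" where
  "kernel_ratio t o' x = (\<Sum>z\<in>X. kernel t o' z * T z x) / kernel t o' x"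

lemma kernel_ratio_nonneg:
  assumes "t \<ge> 0" "o' \<in> X" "x \<in> X"
  shows "0 \<le> kernel_ratio t o' x"
  unfolding kernel_ratio_def using assms
  by (intro divide_nonneg_nonneg sum_nonneg mult_nonneg_nonneg kernel_nonneg T_nonneg) auto

lemma kernel_T_eq_egf:
  assumes "o' \<in> X" "x \<in> X"
  shows "(\<Sum>z\<in>X. kernel t o' z * T z x) = exp (- t) * egf (\<lambda>k. pow (Suc k) o' x) t"
proof -
  have "egf (\<lambda>k. pow (Suc k) o' x) t = egf (\<lambda>k. \<Sum>z\<in>X. T z x * pow k o' z) t"
    using assms by (simp add: pow_Suc_right mult_ac del: mat_pow_on.simps)
  also have "\<dots> = (\<Sum>z\<in>X. T z x * egf (\<lambda>k. pow k o' z) t)"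
    by (rule egf_sum[where b = 1]) (rule pow_bound[OF assms(1)])
  finally show ?thesis by (simp add: kernel_def sum_distrib_left mult_ac del: mat_pow_on.simps)
qed

text \<open>
  The cases \<open>j = 0, 1, 2\<close> are the Poisson moments of orders \<open>0, 1, 2\<close> in disguise.
\<close>

lemma egf_pow_sum:
  assumes "o' \<in> X"
  shows "(\<Sum>x\<in>X. exp (- t) * egf (\<lambda>k. pow (k + j) o' x) t) = 1"
proof -
  have "\<bar>pow (k + j) o' x\<bar> \<le> 1 * 1 ^ k" if "x \<in> X" for x k
    using pow_nonneg[OF assms that, of "k + j"] pow_le_1[OF assms that, of "k + j"] by simp
  then have "(\<Sum>x\<in>X. 1 * egf (\<lambda>k. pow (k + j) o' x) t) = egf (\<lambda>k. \<Sum>x\<in>X. 1 * pow (k + j) o' x) t"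
    by (intro egf_sum[where b = 1, symmetric])
  also have "\<dots> = exp t" using assms by (simp add: pow_sum egf_const_1)
  finally show ?thesis by (simp add: exp_minus flip: sum_distrib_left)
qed

text \<open>
  Conditioning decreases the variance, and \<open>N / t\<close> has mean \<open>1\<close> and variance \<open>1 / t\<close>. Hence
  \<open>kernel_ratio\<close> is bounded except on an event of probability \<open>O(1 / t)\<close>.
\<close>

lemma kernel_ratio_variance:
  assumes t: "t > 0" and o': "o' \<in> X"
  shows "(\<Sum>x\<in>X. kernel t o' x * (kernel_ratio t o' x - 1)\<^sup>2) \<le> 1 / t"
proof -
  let ?F = "\<lambda>j x. exp (- t) * egf (\<lambda>k. pow (k + j) o' x) t"
  have "kernel t o' x * (kernel_ratio t o' x - 1)\<^sup>2 \<le> ?F 2 x + ?F 1 x / t - 2 * ?F 1 x + ?F 0 x"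
    if x: "x \<in> X" for x
  proof -
    have k: "?F 0 x = kernel t o' x" "?F 1 x = (\<Sum>z\<in>X. kernel t o' z * T z x)"
      using kernel_T_eq_egf[OF o' x, of t] by (simp_all add: kernel_def del: mat_pow_on.simps)
    have pos: "?F 0 x > 0" using kernel_pos[OF t o' x] k by simp
    have r: "kernel_ratio t o' x = ?F 1 x / ?F 0 x" unfolding kernel_ratio_def k ..
    have "(egf (\<lambda>k. pow (Suc k) o' x) t)\<^sup>2
        \<le> (egf (\<lambda>k. pow (Suc (Suc k)) o' x) t + egf (\<lambda>k. pow (Suc k) o' x) t / t) * egf (\<lambda>k. pow k o' x) t"
      using pow_bound[OF o' x] pow_nonneg[OF o' x] by (intro egf_cauchy_schwarz t) auto
    from mult_left_mono[OF this, of "(exp (- t))\<^sup>2"]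
    have "(?F 1 x)\<^sup>2 \<le> (?F 2 x + ?F 1 x / t) * ?F 0 x"
      by (simp add: power2_eq_square algebra_simps add_divide_distrib del: mat_pow_on.simps)
    then have "?F 1 x * ?F 1 x / ?F 0 x \<le> ?F 2 x + ?F 1 x / t"
      by (simp only: power2_eq_square pos_divide_le_eq[OF pos])
    moreover have "a * (b / a - 1)\<^sup>2 = b * b / a - 2 * b + a" if "a > 0" for a b :: real
      using that by (simp add: power2_eq_square field_simps)
    from this[OF pos] have "?F 0 x * (?F 1 x / ?F 0 x - 1)\<^sup>2 = ?F 1 x * ?F 1 x / ?F 0 x - 2 * ?F 1 x + ?F 0 x" .
    ultimately show ?thesis unfolding r k(1)[symmetric] by linarith
  qed
  then have "(\<Sum>x\<in>X. kernel t o' x * (kernel_ratio t o' x - 1)\<^sup>2)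
      \<le> (\<Sum>x\<in>X. ?F 2 x + ?F 1 x / t - 2 * ?F 1 x + ?F 0 x)" by (rule sum_mono)
  also have "\<dots> = (\<Sum>x\<in>X. ?F 2 x) + (\<Sum>x\<in>X. ?F 1 x) / t - 2 * (\<Sum>x\<in>X. ?F 1 x) + (\<Sum>x\<in>X. ?F 0 x)"
    by (simp only: sum.distrib sum_subtractf sum_divide_distrib sum_distrib_left)
  also have "\<dots> = 1 / t" by (simp only: egf_pow_sum[OF o'])
  finally show ?thesis .
qed

text \<open>
  The chain reaches \<open>y\<close> in \<open>N + 1\<close> jumps if it reaches \<open>x\<close> in \<open>N\<close> jumps and then steps to \<open>y\<close>. The
  Poisson weights of \<open>N + 1\<close> and \<open>N\<close> have ratio \<open>t / (N + 1)\<close>, whose conditional mean is, by Jensen's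
  inequality, at least the inverse of that of \<open>(N + 1) / t\<close>, which is \<open>1 / t + kernel_ratio t o' x\<close>.
\<close>

lemma kernel_step_ge:
  assumes t: "t > 0" and o': "o' \<in> X" and xy: "x \<in> X" "y \<in> X"
  shows "T x y * kernel t o' x \<le> kernel t o' y * (1 / t + kernel_ratio t o' x)"
proof -
  \<comment> \<open>\<open>egf v\<close> is the series of \<open>pow k o' x\<close> with all Poisson weights moved up by one.\<close>
  define v where "v k = (case k of 0 \<Rightarrow> 0 | Suc j \<Rightarrow> pow j o' x)" for k
  let ?F = "egf (\<lambda>k. pow k o' x) t" and ?F1 = "egf (\<lambda>k. pow (Suc k) o' x) t"
  have v: "0 \<le> v k" "\<bar>v k\<bar> \<le> 1" for k
    using pow_nonneg[OF o' xy(1)] pow_bound[OF o' xy(1)] by (auto simp: v_def split: nat.split)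
  have vbound: "\<bar>v k\<bar> \<le> 1 * 1 ^ k" for k using v by simp
  have turan: "?F\<^sup>2 \<le> (?F1 + ?F / t) * egf v t"
    using egf_cauchy_schwarz[of v t, OF v(2,1) t] by (simp add: v_def del: mat_pow_on.simps)
  have "T x y * egf v t \<le> egf (\<lambda>k. pow k o' y) t"
  proof -
    have "T x y * egf v t = (\<Sum>k. T x y * (t ^ k / fact k * v k))"
      unfolding egf_def by (rule suminf_mult[symmetric, OF summable_egf[OF vbound]])
    also have "\<dots> \<le> (\<Sum>k. t ^ k / fact k * pow k o' y)"
    proof (rule suminf_le)
      show "T x y * (t ^ k / fact k * v k) \<le> t ^ k / fact k * pow k o' y" for k
      proof -
        have "v k * T x y \<le> pow k o' y"
        proof (cases k)
          case 0
          then show ?thesis by (simp add: v_def)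
        next
          case (Suc j)
          have "pow j o' x * T x y \<le> (\<Sum>z\<in>X. pow j o' z * T z y)"
            by (rule member_le_sum) (use finite_X xy o' in \<open>auto intro!: mult_nonneg_nonneg pow_nonneg T_nonneg\<close>)
          then show ?thesis using Suc o' xy by (simp add: v_def pow_Suc_right del: mat_pow_on.simps)
        qed
        from mult_left_mono[OF this, of "t ^ k / fact k"] show ?thesis using t by (simp add: mult_ac)
      qed
    qed (intro summable_mult summable_egf[OF vbound] summable_egf[OF pow_bound] o' xy)+
    finally show ?thesis unfolding egf_def .
  qed
  have F: "?F > 0" using kernel_pos[OF t o' xy(1)] by (simp add: kernel_def zero_less_mult_iff)
  have ratio: "kernel_ratio t o' x = ?F1 / ?F"
    unfolding kernel_ratio_def kernel_T_eq_egf[OF o' xy(1)] by (simp add: kernel_def)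
  have r: "0 \<le> 1 / t + kernel_ratio t o' x" using kernel_ratio_nonneg o' xy t by simp
  have "?F \<le> egf v t * (1 / t + kernel_ratio t o' x)"
    using turan F t unfolding ratio by (simp add: power2_eq_square field_simps)
  then have "T x y * ?F \<le> T x y * (egf v t * (1 / t + kernel_ratio t o' x))"
    by (intro mult_left_mono T_nonneg xy)
  also have "\<dots> \<le> egf (\<lambda>k. pow k o' y) t * (1 / t + kernel_ratio t o' x)"
    using mult_right_mono[OF \<open>T x y * egf v t \<le> _\<close> r] by (simp add: mult.assoc)
  finally show ?thesis by (simp add: kernel_def mult_ac)
qed

lemma chain_degree_ge:
  assumes "x \<in> X" "y \<in> X" "T x y > 0"
  shows "1 / T x y \<le> chain_degree X T"
  unfolding chain_degree_def
proof (rule Max_ge)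
  show "finite {1 / T x y | x y. x \<in> X \<and> y \<in> X \<and> T x y > 0}"
    by (rule finite_subset[of _ "(\<lambda>(x, y). 1 / T x y) ` (X \<times> X)"]) (use finite_X in auto)
qed (use assms in auto)

lemma chain_degree_ge_1: "1 \<le> chain_degree X T"
proof -
  obtain x where x: "x \<in> X" using X_ne by auto
  then obtain y where y: "y \<in> X" "T x y > 0"
    using T_sum[OF x] sum_nonpos[of X "T x"] by (force simp: not_less)
  have "1 \<le> 1 / T x y" using T_le_1[OF x y(1)] y by simp
  then show ?thesis using chain_degree_ge[OF x y] by simp
qed

text \<open>
  One factor \<open>d\<close> is the price of the step from \<open>x\<close> to \<open>y\<close> in \<open>kernel_step_ge\<close>; the other one, through
  the reverse step, compares the stationary weights.
\<close>

lemma log_density_drop: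
  assumes sym: "symmetric_support X T" and t: "t > 0" and o': "o' \<in> X"
    and xy: "x \<in> X" "y \<in> X" "T x y > 0"
  shows "log_density (kernel t o') x - log_density (kernel t o') y
    \<le> 2 * ln (chain_degree X T) + ln (1 / t + kernel_ratio t o' x)"
proof -
  let ?m = "kernel t o'" and ?d = "chain_degree X T" and ?Z = "1 / t + kernel_ratio t o' x"
  have T': "T y x > 0" using sym xy by (simp add: symmetric_support_def)
  have d: "?d \<ge> 1" by (rule chain_degree_ge_1)
  have Z: "?Z > 0" using kernel_ratio_nonneg[of t o' x] t o' xy by (simp add: add_pos_nonneg)
  have m: "?m x > 0" "?m y > 0" using kernel_pos t o' xy by auto
  have s: "stat x > 0" "stat y > 0" using stat_pos xy by auto
  have "?m x = 1 / T x y * (T x y * ?m x)" using xy by simp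
  also have "\<dots> \<le> ?d * (?m y * ?Z)"
    by (rule mult_mono[OF chain_degree_ge[OF xy] kernel_step_ge[OF t o' xy(1,2)]]) (use d m xy in auto)
  finally have 1: "ln (?m x) \<le> ln ?d + ln (?m y) + ln ?Z"
    using m d Z by (subst (asm) ln_le_cancel_iff[symmetric]) (auto simp: ln_mult)
  have "stat y = 1 / T y x * (stat y * T y x)" using T' by simp
  also have "\<dots> \<le> ?d * stat x"
    using stat_flow_le[OF xy(1,2)] chain_degree_ge[OF xy(2,1) T'] d s T' by (intro mult_mono) auto
  finally have 2: "ln (stat y) \<le> ln ?d + ln (stat x)"
    using s d by (subst (asm) ln_le_cancel_iff[symmetric]) (auto simp: ln_mult)
  show ?thesis
    unfolding log_density_def using 1 2 m s by (simp add: ln_divide_pos)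
qed

end

section \<open>Entropy and its variance\<close>

context finite_chain
begin

text \<open>
  The log-density has mean \<open>E = Ent\<close> and variance \<open>V\<close> under \<open>\<nu>\<close>. The set \<open>A\<close> where it is at least
  \<open>E / 2\<close> has \<open>\<pi>\<close>-measure at most \<open>exp (- E / 2)\<close>, and by Chebyshev's inequality its complement has
  \<open>\<nu>\<close>-measure at most \<open>4 V / E\<^sup>2\<close>. The distance to equilibrium being at most \<open>1 - \<epsilon>\<close>, these two
  numbers add up to at least \<open>\<epsilon>\<close>: a large entropy forces \<open>V\<close> to be of order \<open>E\<^sup>2\<close>.
\<close>

lemma reverse_pinsker:
  assumes \<nu>: "law_on X \<nu>" and pos: "\<And>x. x \<in> X \<Longrightarrow> \<nu> x > 0"
    and \<epsilon>: "0 < \<epsilon>" and TV: "TV X T \<nu> \<le> 1 - \<epsilon>"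
    and V: "V = (\<Sum>x\<in>X. \<nu> x * (log_density \<nu> x - Ent X T \<nu>)\<^sup>2)"
  shows "(Ent X T \<nu>)\<^sup>2 \<le> 8 / \<epsilon> * V + (2 * ln (2 / \<epsilon>))\<^sup>2"
proof -
  let ?g = "log_density \<nu>" and ?E = "Ent X T \<nu>"
  have V0: "0 \<le> V" unfolding V using less_imp_le[OF pos] by (intro sum_nonneg) auto
  have E0: "0 \<le> ?E" by (rule Ent_nonneg[OF \<nu>])
  show ?thesis
  proof (cases "?E \<le> 2 * ln (2 / \<epsilon>)")
    case True
    then have "?E\<^sup>2 \<le> (2 * ln (2 / \<epsilon>))\<^sup>2" using E0 by (intro power_mono)
    moreover have "0 \<le> 8 / \<epsilon> * V" using V0 \<epsilon> by simp
    ultimately show ?thesis by linarith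
  next
    case False
    define A where "A = {x\<in>X. ?g x \<ge> ?E / 2}"
    have A: "A \<subseteq> X" by (auto simp: A_def)
    have "exp (- (?E / 2)) < \<epsilon> / 2"
    proof -
      have "exp (- (?E / 2)) < exp (- ln (2 / \<epsilon>))" using False by simp
      also have "\<dots> = \<epsilon> / 2" using \<epsilon> by (simp add: exp_minus)
      finally show ?thesis .
    qed
    moreover have "(\<Sum>x\<in>A. stat x) \<le> exp (- (?E / 2))"
    proof -
      have "(\<Sum>x\<in>A. stat x) \<le> (\<Sum>x\<in>A. \<nu> x * exp (- (?E / 2)))"
      proof (rule sum_mono)
        fix x assume "x \<in> A"
        then have x: "x \<in> X" "?g x \<ge> ?E / 2" by (auto simp: A_def)
        have "stat x = \<nu> x * exp (- ?g x)"
          using pos[OF x(1)] stat_pos[OF x(1)] by (simp add: log_density_def exp_minus)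
        also have "\<dots> \<le> \<nu> x * exp (- (?E / 2))"
          using x pos[OF x(1)] by (intro mult_left_mono) auto
        finally show "stat x \<le> \<nu> x * exp (- (?E / 2))" .
      qed
      also have "\<dots> = (\<Sum>x\<in>A. \<nu> x) * exp (- (?E / 2))" by (simp add: sum_distrib_right)
      also have "\<dots> \<le> 1 * exp (- (?E / 2))"
        using sum_mono2[OF finite_X A, of \<nu>] \<nu> by (intro mult_right_mono) (auto simp: law_on_def)
      finally show ?thesis by simp
    qed
    moreover have "(\<Sum>x\<in>A. \<nu> x) - (\<Sum>x\<in>A. stat x) \<le> 1 - \<epsilon>"
      using TV_ge[OF A, of \<nu>] TV by simp
    moreover have "(\<Sum>x\<in>A. \<nu> x) = 1 - (\<Sum>x\<in>X - A. \<nu> x)"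
      using sum.subset_diff[OF A finite_X, of \<nu>] \<nu> by (simp add: law_on_def)
    ultimately have "\<epsilon> / 2 \<le> (\<Sum>x\<in>X - A. \<nu> x)" by simp
    then have "\<epsilon> / 2 * (?E / 2)\<^sup>2 \<le> (\<Sum>x\<in>X - A. \<nu> x) * (?E / 2)\<^sup>2"
      by (intro mult_right_mono) auto
    also have "\<dots> \<le> (\<Sum>x\<in>X - A. \<nu> x * (?g x - ?E)\<^sup>2)"
      unfolding sum_distrib_right
    proof (rule sum_mono)
      fix x assume "x \<in> X - A"
      then have x: "x \<in> X" "?g x < ?E / 2" by (auto simp: A_def)
      have "(?E / 2)\<^sup>2 \<le> (?E - ?g x)\<^sup>2" using x E0 by (intro power_mono) auto
      then show "\<nu> x * (?E / 2)\<^sup>2 \<le> \<nu> x * (?g x - ?E)\<^sup>2"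
        using pos[OF x(1)] by (intro mult_left_mono) (auto simp: power2_commute)
    qed
    also have "\<dots> \<le> V"
      unfolding V using finite_X less_imp_le[OF pos] by (intro sum_mono2) auto
    finally have "?E\<^sup>2 \<le> 8 / \<epsilon> * V" using \<epsilon> by (simp add: power_divide field_simps)
    then show ?thesis using zero_le_power2[of "2 * ln (2 / \<epsilon>)"] by linarith
  qed
qed

text \<open>
  For diffusions the left-hand side equals \<open>2 * dissipation m\<close> by the chain rule. Here the increments
  of the log-density drop by at most \<open>O(D)\<close> as long as \<open>Z = 1 / t + kernel_ratio t o' x\<close> is at most
  \<open>4\<close>, and \<open>sq_le_Phi\<close> applies. Where \<open>Z > 4\<close>, downward increments are \<open>O(D (Z - 1 - 1 / t))\<close>, and the
  mean square of the last factor is at most \<open>1 / t\<close>. The gain of \<open>1 / t\<close> is what makes this exceptional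
  part harmless after multiplication by \<open>t\<close> in the Poincare inequality.
\<close>

lemma approximate_chain_rule:
  assumes sym: "symmetric_support X T" and t: "t \<ge> 1" and o': "o' \<in> X"
  defines "m \<equiv> kernel t o'" and "D \<equiv> 1 + ln (chain_degree X T)"
  shows "(\<Sum>x\<in>X. m x * (\<Sum>y\<in>X. T x y * (log_density m y - log_density m x)\<^sup>2))
    \<le> 6 * D * dissipation m + 10 * D\<^sup>2 / t"
proof -
  let ?g = "log_density m" and ?l = "ln (chain_degree X T)"
  have l: "0 \<le> ?l" using chain_degree_ge_1 by simp
  have D: "D \<ge> 1" using l by (simp add: D_def)
  have point: "T x y * (?g y - ?g x)\<^sup>2
      \<le> 6 * D * (T x y * Phi (?g y - ?g x)) + 10 * D\<^sup>2 * (T x y * (kernel_ratio t o' x - 1)\<^sup>2)"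
    if xy: "x \<in> X" "y \<in> X" for x y
  proof (cases "T x y > 0")
    case True
    define u where "u = ?g y - ?g x"
    define r where "r = kernel_ratio t o' x"
    define Z where "Z = 1 / t + r"
    have drop: "- u \<le> 2 * ?l + ln Z"
      using log_density_drop[OF sym _ o' xy True, of t] t by (simp add: u_def Z_def m_def r_def)
    have r: "r \<ge> 0" unfolding r_def using t o' xy by (intro kernel_ratio_nonneg) auto
    have "u\<^sup>2 \<le> 6 * D * Phi u + 10 * D\<^sup>2 * (r - 1)\<^sup>2"
    proof (cases "- u \<le> 2 * ?l + ln 4")
      case True
      have ln4: "ln 4 \<le> (2 :: real)"
      proof -
        have "ln 4 = 2 * ln (2 :: real)" using ln_realpow[of 2 2] by simp
        then show ?thesis using ln_le_minus_one[of "2 :: real"] by simp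
      qed
      have "u\<^sup>2 \<le> 2 * (1 + (2 * ?l + ln 4)) * Phi u"
        using True l by (intro sq_le_Phi) auto
      also have "\<dots> \<le> 6 * D * Phi u"
        using ln4 l Phi_nonneg[of u] by (intro mult_right_mono) (auto simp: D_def)
      also have "\<dots> \<le> 6 * D * Phi u + 10 * D\<^sup>2 * (r - 1)\<^sup>2" by simp
      finally show ?thesis .
    next
      case False
      have "Z > 0" using r t by (simp add: Z_def add_pos_nonneg)
      have "ln 4 < ln Z" using False drop by simp
      then have Z: "Z > 4" using \<open>Z > 0\<close> by simp
      have u: "0 \<le> - u" "- u \<le> 2 * ?l + ln Z"
        using False drop l ln_ge_zero[of "4 :: real"] by linarith+
      have lnZ: "0 \<le> ln Z" "ln Z \<le> Z" using Z ln_le_minus_one[of Z] by auto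
      have r1: "r - 1 \<ge> Z / 2" using Z t by (simp add: Z_def field_simps)
      have "(- u)\<^sup>2 \<le> (2 * ?l + Z)\<^sup>2" using u lnZ by (intro power_mono) auto
      also have "\<dots> \<le> (2 * D * (r - 1))\<^sup>2"
      proof (intro power_mono)
        have "2 * ?l * 1 \<le> 2 * ?l * (r - 1)" using l r1 Z by (intro mult_left_mono) auto
        then show "2 * ?l + Z \<le> 2 * D * (r - 1)" using r1 by (simp add: D_def algebra_simps)
      qed (use l Z in simp)
      also have "\<dots> \<le> 10 * D\<^sup>2 * (r - 1)\<^sup>2" by (simp add: power_mult_distrib mult_right_mono)
      finally show ?thesis using Phi_nonneg[of u] D by (simp add: add_increasing)
    qed
    from mult_left_mono[OF this T_nonneg[OF xy]] show ?thesis
      by (simp add: u_def r_def algebra_simps)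
  next
    case False
    then have "T x y = 0" using T_nonneg[OF xy] by simp
    then show ?thesis by simp
  qed
  have m0: "0 \<le> m x" if "x \<in> X" for x
    unfolding m_def using that t o' by (intro kernel_nonneg) auto
  have "(\<Sum>x\<in>X. m x * (\<Sum>y\<in>X. T x y * (?g y - ?g x)\<^sup>2))
      \<le> (\<Sum>x\<in>X. m x * (\<Sum>y\<in>X. 6 * D * (T x y * Phi (?g y - ?g x)) + 10 * D\<^sup>2 * (T x y * (kernel_ratio t o' x - 1)\<^sup>2)))"
    by (intro sum_mono mult_left_mono point m0)
  also have "\<dots> = (\<Sum>x\<in>X. 6 * D * (m x * (\<Sum>y\<in>X. T x y * Phi (?g y - ?g x)))
      + 10 * D\<^sup>2 * (m x * (kernel_ratio t o' x - 1)\<^sup>2))"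
  proof (rule sum.cong)
    fix x assume x: "x \<in> X"
    have "(\<Sum>y\<in>X. 6 * D * (T x y * Phi (?g y - ?g x)) + 10 * D\<^sup>2 * (T x y * (kernel_ratio t o' x - 1)\<^sup>2))
        = 6 * D * (\<Sum>y\<in>X. T x y * Phi (?g y - ?g x)) + 10 * D\<^sup>2 * (kernel_ratio t o' x - 1)\<^sup>2"
      using T_sum[OF x] by (simp add: sum.distrib flip: sum_distrib_left sum_distrib_right)
    then show "m x * (\<Sum>y\<in>X. 6 * D * (T x y * Phi (?g y - ?g x)) + 10 * D\<^sup>2 * (T x y * (kernel_ratio t o' x - 1)\<^sup>2))
        = 6 * D * (m x * (\<Sum>y\<in>X. T x y * Phi (?g y - ?g x))) + 10 * D\<^sup>2 * (m x * (kernel_ratio t o' x - 1)\<^sup>2)"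
      by (simp only: distrib_left mult.left_commute)
  qed simp
  also have "\<dots> = 6 * D * dissipation m + 10 * D\<^sup>2 * (\<Sum>x\<in>X. m x * (kernel_ratio t o' x - 1)\<^sup>2)"
    unfolding dissipation_def by (simp only: sum.distrib sum_distrib_left)
  also have "\<dots> \<le> 6 * D * dissipation m + 10 * D\<^sup>2 * (1 / t)"
    using kernel_ratio_variance[OF _ o', of t] t
    by (intro add_left_mono mult_left_mono) (auto simp: m_def)
  finally show ?thesis by simp
qed

lemma varentropy_bound:
  assumes curv: "nonneg_curved X T" and sym: "symmetric_support X T" and t: "t \<ge> 1" and o': "o' \<in> X"
  defines "m \<equiv> law_at X T (\<lambda>x. of_bool (x = o')) t" and "D \<equiv> 1 + ln (chain_degree X T)"
  shows "(\<Sum>x\<in>X. m x * (log_density m x - Ent X T m)\<^sup>2) \<le> 6 * t * D * dissipation m + 10 * D\<^sup>2"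
proof -
  have m: "m x = kernel t o' x" if "x \<in> X" for x
    unfolding m_def using law_at_point_mass o' that by simp
  have g: "log_density m x = log_density (kernel t o') x" if "x \<in> X" for x
    using m[OF that] by (simp add: log_density_def)
  have law: "law_on X m" unfolding m_def using t o' by (intro law_on_law_at law_on_point_mass) auto
  let ?g = "log_density (kernel t o')" and ?E = "Ent X T m"
  have diss: "dissipation m = dissipation (kernel t o')"
    unfolding dissipation_def by (intro sum.cong arg_cong2[of _ _ _ _ "(*)"]) (auto simp: m g)
  have E: "?E = (\<Sum>x\<in>X. kernel t o' x * ?g x)"
    unfolding Ent_eq by (intro sum.cong) (auto simp: m g)
  have "(\<Sum>x\<in>X. m x * (log_density m x - ?E)\<^sup>2)
      = (\<Sum>x\<in>X. kernel t o' x * (?g x)\<^sup>2 - 2 * ?E * (kernel t o' x * ?g x) + ?E\<^sup>2 * kernel t o' x)"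
    by (intro sum.cong refl) (simp add: m g power2_diff algebra_simps)
  also have "\<dots> = (\<Sum>x\<in>X. kernel t o' x * (?g x)\<^sup>2) - 2 * ?E * (\<Sum>x\<in>X. kernel t o' x * ?g x)
      + ?E\<^sup>2 * (\<Sum>x\<in>X. kernel t o' x)"
    by (simp only: sum.distrib sum_subtractf sum_distrib_left)
  also have "\<dots> = (\<Sum>x\<in>X. kernel t o' x * (?g x)\<^sup>2) - (\<Sum>x\<in>X. kernel t o' x * ?g x)\<^sup>2"
    unfolding kernel_sum[OF o'] E[symmetric] by (simp add: power2_eq_square)
  also have "\<dots> \<le> t * (\<Sum>x\<in>X. kernel t o' x * (\<Sum>y\<in>X. T x y * (?g y - ?g x)\<^sup>2))"
    using t by (intro local_poincare curv o') simp
  also have "\<dots> \<le> t * (6 * D * dissipation (kernel t o') + 10 * D\<^sup>2 / t)"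
    unfolding D_def using t by (intro mult_left_mono approximate_chain_rule sym o') auto
  also have "\<dots> = 6 * t * D * dissipation m + 10 * D\<^sup>2"
    using t by (simp add: diss algebra_simps)
  finally show ?thesis .
qed

end

text \<open>
  As long as \<open>E > 2 Q\<close>, the hypothesis implies \<open>E\<^sup>2 \<le> 2 P D\<close>, that is,
  \<open>(1 / E)' \<ge> 1 / (2 P)\<close>. Hence
  \<open>1 / E b \<ge> (b - a) / (2 P)\<close>, no matter how large \<open>E a\<close> is.
\<close>

lemma riccati_decay:
  fixes E D :: "real \<Rightarrow> real"
  assumes ab: "a < b" and PQ: "P > 0" "Q > 0"
    and deriv: "\<And>s. a \<le> s \<Longrightarrow> s \<le> b \<Longrightarrow> (E has_real_derivative - D s) (at s)"
    and nonneg: "\<And>s. a \<le> s \<Longrightarrow> s \<le> b \<Longrightarrow> 0 \<le> D s"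
    and le: "\<And>s. a \<le> s \<Longrightarrow> s \<le> b \<Longrightarrow> (E s)\<^sup>2 \<le> P * D s + Q\<^sup>2"
  shows "E b \<le> 2 * Q + 2 * P / (b - a)"
proof (cases "E b \<le> 2 * Q")
  case True
  then show ?thesis using PQ ab by (simp add: add_increasing2)
next
  case False
  have E: "E s > 2 * Q" if s: "a \<le> s" "s \<le> b" for s
  proof -
    have "E b \<le> E s"
    proof (rule DERIV_nonpos_imp_nonincreasing[OF s(2)])
      fix r assume "s \<le> r" "r \<le> b"
      then show "\<exists>y. DERIV E r :> y \<and> y \<le> 0" using deriv[of r] nonneg[of r] s by force
    qed
    then show ?thesis using False by simp
  qed
  have "1 / E a - a / (2 * P) \<le> 1 / E b - b / (2 * P)"
  proof (rule DERIV_nonneg_imp_nondecreasing[of a b "\<lambda>s. 1 / E s - s / (2 * P)"])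
    fix s assume s: "a \<le> s" "s \<le> b"
    have Es: "E s > 2 * Q" "E s > 0" using E[OF s] PQ by auto
    have "((\<lambda>s. 1 / E s - s / (2 * P)) has_real_derivative D s / (E s)\<^sup>2 - 1 / (2 * P)) (at s)"
      using Es PQ by (auto intro!: derivative_eq_intros deriv s simp: power2_eq_square)
    moreover have "1 / (2 * P) \<le> D s / (E s)\<^sup>2"
    proof -
      have "(2 * Q)\<^sup>2 \<le> (E s)\<^sup>2" using Es PQ by (intro power_mono) auto
      then have "4 * Q\<^sup>2 \<le> (E s)\<^sup>2" by (simp add: power_mult_distrib)
      then have "2 * Q\<^sup>2 \<le> (E s)\<^sup>2" using zero_le_power2[of Q] by linarith
      then have "(E s)\<^sup>2 \<le> 2 * P * D s" using le[OF s] by simp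
      then show ?thesis using Es PQ by (simp add: field_simps)
    qed
    ultimately show "\<exists>y. ((\<lambda>s. 1 / E s - s / (2 * P)) has_real_derivative y) (at s) \<and> 0 \<le> y"
      by (intro exI[of _ "D s / (E s)\<^sup>2 - 1 / (2 * P)"]) simp
  qed (use ab in simp)
  moreover have "1 / E a > 0" using E[of a] ab PQ by simp
  ultimately have "(b - a) / (2 * P) \<le> 1 / E b" unfolding diff_divide_distrib by linarith
  moreover have "E b > 0" using E[of b] ab PQ by simp
  ultimately have "E b \<le> 2 * P / (b - a)" using ab PQ by (simp add: field_simps)
  then show ?thesis using PQ by simp
qed

text \<open>
  An explicit constant produced by the argument; what matters is that it is independent of the chain.
\<close>

definition cutoff_const :: "real \<Rightarrow> real \<Rightarrow> real" where
  "cutoff_const \<epsilon> \<delta> = 2 * sqrt (80 / \<epsilon> + (2 * ln (2 / \<epsilon>))\<^sup>2) + 96 / \<epsilon> * (1 + \<delta>) / \<delta>"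

context finite_chain
begin

text \<open>
  The reverse Pinsker inequality and the bound on the variance of the log-density combine to the
  hypothesis of \<open>riccati_decay\<close>, with \<open>P\<close> proportional to \<open>t D\<close> and \<open>Q\<close> to \<open>D = 1 + ln d\<close>. On an interval
  of length \<open>\<delta> t\<close> the factor \<open>t\<close> cancels: the entropy falls to \<open>O(1 + ln d)\<close>.
\<close>

lemma entropy_after_mixing:
  assumes curv: "nonneg_curved X T" and sym: "symmetric_support X T" and o': "o' \<in> X"
    and \<epsilon>: "0 < \<epsilon>" "\<epsilon> < 1" and \<delta>: "\<delta> > 0"
    and t: "t \<ge> 1" and TV: "TV X T (law_at X T (\<lambda>x. of_bool (x = o')) t) \<le> 1 - \<epsilon>"
  shows "Ent X T (law_at X T (\<lambda>x. of_bool (x = o')) ((1 + \<delta>) * t))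
    \<le> cutoff_const \<epsilon> \<delta> * (1 + ln (chain_degree X T))"
proof -
  let ?\<mu> = "\<lambda>x. of_bool (x = o') :: real"
  define m where "m s = law_at X T ?\<mu> s" for s
  define D where "D = 1 + ln (chain_degree X T)"
  define Q where "Q = sqrt (80 / \<epsilon> + (2 * ln (2 / \<epsilon>))\<^sup>2) * D"
  define P where "P = 48 / \<epsilon> * ((1 + \<delta>) * t) * D"
  have \<mu>: "law_on X ?\<mu>" by (rule law_on_point_mass[OF o'])
  have D: "D \<ge> 1" using chain_degree_ge_1 by (simp add: D_def)
  have Q2: "Q\<^sup>2 = (80 / \<epsilon> + (2 * ln (2 / \<epsilon>))\<^sup>2) * D\<^sup>2"
    using \<epsilon> by (simp add: Q_def power_mult_distrib)
  have "Ent X T (m ((1 + \<delta>) * t)) \<le> 2 * Q + 2 * P / ((1 + \<delta>) * t - t)"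
  proof (rule riccati_decay[where D = "\<lambda>s. dissipation (m s)" and E = "\<lambda>s. Ent X T (m s)"])
    show "t < (1 + \<delta>) * t" using t \<delta> by simp
    show "P > 0" using t \<delta> \<epsilon> D by (simp add: P_def)
    have "80 / \<epsilon> + (2 * ln (2 / \<epsilon>))\<^sup>2 > 0" using \<epsilon> by (simp add: add_pos_nonneg)
    then show "Q > 0" using D by (simp add: Q_def)
    fix s assume s: "t \<le> s" "s \<le> (1 + \<delta>) * t"
    have s1: "s \<ge> 1" using s t by simp
    have law: "law_on X (m s)" unfolding m_def using s1 by (intro law_on_law_at \<mu>) simp
    have pos: "m s x > 0" if "x \<in> X" for x unfolding m_def using s1 that by (intro law_at_pos \<mu>) auto
    show "((\<lambda>s. Ent X T (m s)) has_real_derivative - dissipation (m s)) (at s)"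
      unfolding m_def using s1 by (intro Ent_deriv \<mu>) simp
    show diss: "0 \<le> dissipation (m s)" by (rule dissipation_nonneg[OF law])
    have "TV X T (m s) \<le> 1 - \<epsilon>"
      using TV_mono_time[OF \<mu>, of t s] TV s t by (simp add: m_def)
    from reverse_pinsker[OF law pos \<epsilon>(1) this refl]
    have "(Ent X T (m s))\<^sup>2 \<le> 8 / \<epsilon> * (\<Sum>x\<in>X. m s x * (log_density (m s) x - Ent X T (m s))\<^sup>2) + (2 * ln (2 / \<epsilon>))\<^sup>2" .
    also have "\<dots> \<le> 8 / \<epsilon> * (6 * s * D * dissipation (m s) + 10 * D\<^sup>2) + (2 * ln (2 / \<epsilon>))\<^sup>2"
      using varentropy_bound[OF curv sym s1 o'] \<epsilon>
      by (intro add_right_mono mult_left_mono) (auto simp: m_def D_def)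
    also have "\<dots> = 48 / \<epsilon> * s * D * dissipation (m s) + 80 / \<epsilon> * D\<^sup>2 + (2 * ln (2 / \<epsilon>))\<^sup>2 * 1"
      by (simp add: algebra_simps)
    also have "\<dots> \<le> 48 / \<epsilon> * ((1 + \<delta>) * t) * D * dissipation (m s) + 80 / \<epsilon> * D\<^sup>2 + (2 * ln (2 / \<epsilon>))\<^sup>2 * D\<^sup>2"
      using s \<epsilon> D diss by (intro add_mono mult_right_mono mult_left_mono) auto
    also have "\<dots> = P * dissipation (m s) + Q\<^sup>2"
      unfolding Q2 P_def by (simp add: algebra_simps)
    finally show "(Ent X T (m s))\<^sup>2 \<le> P * dissipation (m s) + Q\<^sup>2" .
  qed
  also have "2 * P / ((1 + \<delta>) * t - t) = 96 / \<epsilon> * (1 + \<delta>) / \<delta> * D"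
    using t \<delta> \<epsilon> by (simp add: P_def field_simps)
  also have "2 * Q + 96 / \<epsilon> * (1 + \<delta>) / \<delta> * D = cutoff_const \<epsilon> \<delta> * D"
    by (simp add: Q_def cutoff_const_def algebra_simps)
  finally show ?thesis by (simp add: m_def D_def)
qed

end

section \<open>Mixing times\<close>

context finite_chain
begin

lemma t_mix_from_attained:
  assumes o': "o' \<in> X" and \<epsilon>: "\<epsilon> > 0"
  shows "t_mix_from X T o' \<epsilon> \<ge> 0 \<and> TV X T (law_at X T (\<lambda>x. of_bool (x = o')) (t_mix_from X T o' \<epsilon>)) \<le> \<epsilon>"
    and t_mix_from_le: "t \<ge> 0 \<Longrightarrow> TV X T (law_at X T (\<lambda>x. of_bool (x = o')) t) \<le> \<epsilon> \<Longrightarrow> t_mix_from X T o' \<epsilon> \<le> t"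
proof -
  let ?\<mu> = "\<lambda>x. of_bool (x = o') :: real"
  let ?S = "{t. t \<ge> 0 \<and> TV X T (law_at X T ?\<mu> t) \<le> \<epsilon>}"
  have \<mu>: "law_on X ?\<mu>" by (rule law_on_point_mass[OF o'])
  have ne: "?S \<noteq> {}"
  proof -
    obtain c where c: "c \<in> mls_constants" using mls_constants_ne by auto
    then have c0: "c > 0" by (simp add: mls_constants_def)
    have "((\<lambda>t. Ent X T ?\<mu> * exp (- t / c)) \<longlongrightarrow> Ent X T ?\<mu> * 0) at_top"
    proof (intro tendsto_mult tendsto_const filterlim_compose[OF exp_at_bot])
      show "filterlim (\<lambda>t. - t / c) at_bot at_top"
        using filterlim_tendsto_pos_mult_at_bot[OF tendsto_const[of "1 / c"] _ filterlim_uminus_at_bot_at_top] c0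
        by simp
    qed
    then have "\<forall>\<^sub>F t in at_top. Ent X T ?\<mu> * exp (- t / c) < \<epsilon>\<^sup>2 / 4"
      using \<epsilon> by (intro order_tendstoD(2)) auto
    then have "\<forall>\<^sub>F t in at_top. t \<ge> 0 \<and> Ent X T ?\<mu> * exp (- t / c) < \<epsilon>\<^sup>2 / 4"
      using eventually_ge_at_top[of "0 :: real"] by eventually_elim simp
    then obtain t :: real where t: "t \<ge> 0" "Ent X T ?\<mu> * exp (- t / c) < \<epsilon>\<^sup>2 / 4"
      unfolding eventually_at_top_linorder by blast
    have "Ent X T (law_at X T ?\<mu> t) \<le> \<epsilon>\<^sup>2 / 4" using mls_constantsD[OF c \<mu> t(1)] t(2) by simp
    then have "sqrt (Ent X T (law_at X T ?\<mu> t)) \<le> \<epsilon> / 2"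
      using \<epsilon> by (intro real_le_lsqrt) (auto simp: power_divide)
    then have "TV X T (law_at X T ?\<mu> t) \<le> \<epsilon>"
      using TV_le_sqrt_Ent[OF law_on_law_at[OF \<mu> t(1)]] by simp
    then show ?thesis using t by auto
  qed
  have bdd: "bdd_below ?S" by (auto intro: bdd_belowI[of _ 0])
  have Inf: "Inf ?S \<in> ?S" by (rule closed_contains_Inf[OF ne bdd closed_TV_sublevel])
  have Inf_le: "Inf ?S \<le> t" if "t \<in> ?S" for t
    using that bdd by (rule cInf_lower)
  have eq: "t_mix_from X T o' \<epsilon> = Inf ?S"
    unfolding t_mix_from_def by (rule Least_equality) (use Inf Inf_le in auto)
  with Inf show "t_mix_from X T o' \<epsilon> \<ge> 0 \<and> TV X T (law_at X T ?\<mu> (t_mix_from X T o' \<epsilon>)) \<le> \<epsilon>"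
    by simp
  show "t_mix_from X T o' \<epsilon> \<le> t" if "t \<ge> 0" "TV X T (law_at X T ?\<mu> t) \<le> \<epsilon>"
    unfolding eq using that by (intro Inf_le) simp
qed

lemma t_mix_from_antimono:
  assumes "o' \<in> X" "0 < \<epsilon>" "\<epsilon> \<le> \<epsilon>'"
  shows "t_mix_from X T o' \<epsilon>' \<le> t_mix_from X T o' \<epsilon>"
  using t_mix_from_attained[OF assms(1,2)] assms by (intro t_mix_from_le) auto

text \<open>
  At the time \<open>(1 + \<delta>) (t_mix_from X T o' (1 - \<epsilon>) + 1)\<close> the entropy is
  \<open>O(1 + ln d)\<close>, and it then decays exponentially at rate
  \<open>1 / t_mls\<close>, up to constants: a further time of order \<open>t_mls * (1 + ln (1 + ln d))\<close> makes it small.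
\<close>

lemma t_mix_from_window:
  assumes curv: "nonneg_curved X T" and sym: "symmetric_support X T" and o': "o' \<in> X"
    and card: "card X \<ge> 2" and \<epsilon>: "0 < \<epsilon>" "\<epsilon> < 1" and \<delta>: "\<delta> > 0"
  shows "t_mix_from X T o' \<epsilon> \<le> (1 + \<delta>) * t_mix_from X T o' (1 - \<epsilon>)
    + (64 * (1 + \<delta>) + 2 * (ln (4 * cutoff_const \<epsilon> \<delta> / \<epsilon>\<^sup>2) + 2))
      * (t_mls X T * max 1 (ln (ln (chain_degree X T))))"
proof -
  let ?\<mu> = "\<lambda>x. of_bool (x = o') :: real"
  define D where "D = 1 + ln (chain_degree X T)"
  define M where "M = max 1 (ln (ln (chain_degree X T)))"
  define \<tau> where "\<tau> = t_mls X T"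
  define C where "C = cutoff_const \<epsilon> \<delta>"
  define K where "K = 4 * C / \<epsilon>\<^sup>2"
  \<comment> \<open>The shift by one puts \<open>t0\<close> into the range \<open>t \<ge> 1\<close> of \<open>entropy_after_mixing\<close> even when the mixing
      time is \<open>0\<close>. The time \<open>s\<close> is what it takes, at rate \<open>1 / (2 * \<tau>)\<close>, to bring an entropy \<open>C * D\<close>
      down to \<open>\<epsilon>\<^sup>2 / 4\<close>, and thus the distance to equilibrium down to \<open>\<epsilon>\<close>.\<close>
  define t0 where "t0 = t_mix_from X T o' (1 - \<epsilon>) + 1"
  define s where "s = 2 * \<tau> * ln (K * D)"
  have \<mu>: "law_on X ?\<mu>" by (rule law_on_point_mass[OF o'])
  have l: "ln (chain_degree X T) \<ge> 0" using chain_degree_ge_1 by simp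
  then have D: "D \<ge> 1" by (simp add: D_def)
  have \<tau>: "\<tau> \<ge> 1 / 64" unfolding \<tau>_def by (rule t_mls_ge[OF card])
  have M: "M \<ge> 1" by (simp add: M_def)
  have C: "C \<ge> 1"
  proof -
    have "1 * 1 \<le> 96 / \<epsilon> * ((1 + \<delta>) / \<delta>)" using \<epsilon> \<delta> by (intro mult_mono) auto
    moreover have "0 \<le> 2 * sqrt (80 / \<epsilon> + (2 * ln (2 / \<epsilon>))\<^sup>2)" using \<epsilon> by simp
    ultimately show ?thesis unfolding C_def cutoff_const_def times_divide_eq_right[symmetric] by linarith
  qed
  have K: "K \<ge> 1"
  proof -
    have "\<epsilon>\<^sup>2 \<le> 1" using \<epsilon> by (simp add: power_le_one)
    then show ?thesis using C \<epsilon> by (simp add: K_def field_simps)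
  qed
  have KD: "K * D \<ge> 1" using mult_mono[OF K D] K by simp
  have lnD: "ln D \<le> 2 * M"
  proof (cases "ln (chain_degree X T) \<le> 2")
    case True
    have "ln D \<le> D - 1" using D by (intro ln_le_minus_one) simp
    then show ?thesis using True M by (simp add: D_def)
  next
    case False
    then have "ln D \<le> ln (2 * ln (chain_degree X T))" by (simp add: D_def)
    also have "\<dots> = ln 2 + ln (ln (chain_degree X T))" using False by (simp add: ln_mult)
    also have "ln (2 :: real) \<le> 1" using ln_le_minus_one[of "2 :: real"] by simp
    finally show ?thesis by (simp add: M_def)
  qed
  have t0: "t0 \<ge> 1" and TV0: "TV X T (law_at X T ?\<mu> t0) \<le> 1 - \<epsilon>"
  proof -
    have e: "t_mix_from X T o' (1 - \<epsilon>) \<ge> 0 \<and> TV X T (law_at X T ?\<mu> (t_mix_from X T o' (1 - \<epsilon>))) \<le> 1 - \<epsilon>"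
      using \<epsilon> by (intro t_mix_from_attained o') simp
    then show "t0 \<ge> 1" by (simp add: t0_def)
    show "TV X T (law_at X T ?\<mu> t0) \<le> 1 - \<epsilon>"
      using e TV_mono_time[OF \<mu>, of "t_mix_from X T o' (1 - \<epsilon>)" t0] by (simp add: t0_def)
  qed
  have s: "s \<ge> 0" using \<tau> KD by (simp add: s_def)
  define m where "m = law_at X T ?\<mu> ((1 + \<delta>) * t0)"
  have law: "law_on X m" unfolding m_def using t0 \<delta> by (intro law_on_law_at \<mu>) simp
  have "Ent X T (law_at X T m s) \<le> Ent X T m * exp (- s / (2 * \<tau>))"
    unfolding \<tau>_def using \<tau> by (intro Ent_decay_t_mls law s) (simp add: \<tau>_def)
  also have "\<dots> \<le> C * D * exp (- s / (2 * \<tau>))"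
    using entropy_after_mixing[OF curv sym o' \<epsilon> \<delta> t0 TV0]
    by (intro mult_right_mono) (auto simp: m_def C_def D_def)
  also have "exp (- s / (2 * \<tau>)) = 1 / (K * D)"
    using \<tau> KD K D by (simp add: s_def exp_minus field_simps)
  also have "C * D * (1 / (K * D)) = \<epsilon>\<^sup>2 / 4" using C D by (simp add: K_def)
  finally have "sqrt (Ent X T (law_at X T m s)) \<le> \<epsilon> / 2"
    using \<epsilon> by (intro real_le_lsqrt) (auto simp: power_divide)
  then have "TV X T (law_at X T m s) \<le> \<epsilon>"
    using TV_le_sqrt_Ent[OF law_on_law_at[OF law s]] by simp
  then have "t_mix_from X T o' \<epsilon> \<le> (1 + \<delta>) * t0 + s"
    using t0 s \<delta> \<epsilon> by (intro t_mix_from_le o') (auto simp: law_at_add[OF \<mu>] m_def)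
  moreover have "s \<le> 2 * (ln K + 2) * (\<tau> * M)"
  proof -
    have "ln (K * D) = ln K + ln D" using K D by (simp add: ln_mult)
    also have "\<dots> \<le> ln K * M + 2 * M" using lnD mult_left_mono[OF M, of "ln K"] K by simp
    finally have "2 * \<tau> * ln (K * D) \<le> 2 * \<tau> * (ln K * M + 2 * M)"
      using \<tau> by (intro mult_left_mono) auto
    then show ?thesis by (simp add: s_def algebra_simps)
  qed
  moreover have "(1 + \<delta>) * 1 \<le> (1 + \<delta>) * (64 * (\<tau> * M))"
  proof (intro mult_left_mono)
    have "1 / 64 * 1 \<le> \<tau> * M" using \<tau> M by (intro mult_mono) auto
    then show "1 \<le> 64 * (\<tau> * M)" by simp
  qed (use \<delta> in simp)
  ultimately have "t_mix_from X T o' \<epsilon> \<le> (1 + \<delta>) * t_mix_from X T o' (1 - \<epsilon>)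
      + (64 * (1 + \<delta>) + 2 * (ln K + 2)) * (\<tau> * M)"
    by (simp add: t0_def algebra_simps)
  then show ?thesis by (simp add: K_def C_def \<tau>_def M_def)
qed

end

text \<open>
  Like \<open>cutoff_const\<close>, this does not involve the chain, so that it is the same along a sequence of chains.
\<close>

definition window_const :: "real \<Rightarrow> real \<Rightarrow> real" where
  "window_const \<epsilon> \<delta> = 64 * (1 + \<delta>) + 2 * (ln (4 * cutoff_const \<epsilon> \<delta> / \<epsilon>\<^sup>2) + 2)"

text \<open>
  On a singleton \<open>t_mls\<close> is \<open>0\<close>, and the lower bound \<open>t_mls_ge\<close> fails. Such chains are excluded by the
  divergence of the ratio in the criterion, as its numerator vanishes.
\<close>

lemma t_mix_singleton:
  assumes triple: "markov_triple X T S" and card: "card X < 2" and \<epsilon>: "\<epsilon> > 0"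
  shows "t_mix X T S \<epsilon> = 0"
proof -
  from triple have fin: "finite X" and S: "S \<subseteq> X" "S \<noteq> {}" by (auto simp: markov_triple_def)
  then have "card X \<noteq> 0" by (auto simp: card_eq_0_iff)
  with card have "card X = 1" by simp
  then obtain a where X: "X = {a}" by (auto simp: card_1_singleton_iff)
  with S have S: "S = {a}" by auto
  interpret finite_chain X T
    using triple X by unfold_locales (auto simp: markov_triple_def)
  have law: "\<mu> = stat" if "law_on X \<mu>" for \<mu>
  proof
    fix x
    show "\<mu> x = stat x" using that stat_law X by (cases "x = a") (auto simp: law_on_def)
  qed
  let ?\<mu> = "\<lambda>x. of_bool (x = a) :: real"
  have \<mu>: "law_on X ?\<mu>" using X by (intro law_on_point_mass) simp
  have "TV X T (law_at X T ?\<mu> 0) \<le> 0"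
    unfolding law[OF \<mu>] by (rule TV_le) (simp add: law_at_stat)
  then have "t_mix_from X T a \<epsilon> \<le> 0" using X \<epsilon> by (intro t_mix_from_le) auto
  moreover have "t_mix_from X T a \<epsilon> \<ge> 0" using t_mix_from_attained(1)[of a \<epsilon>] X \<epsilon> by simp
  ultimately show ?thesis by (simp add: t_mix_def S)
qed

lemma finite_chain_if_markov_triple: "markov_triple X T S \<Longrightarrow> finite_chain X T"
  by unfold_locales (auto simp: markov_triple_def)

lemma t_mix_antimono:
  assumes triple: "markov_triple X T S" and "0 < \<epsilon>" "\<epsilon> \<le> \<epsilon>'"
  shows "t_mix X T S \<epsilon>' \<le> t_mix X T S \<epsilon>"
proof -
  interpret finite_chain X T by (rule finite_chain_if_markov_triple[OF triple])
  have S: "finite S" "S \<noteq> {}" "S \<subseteq> X"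
    using triple finite_X by (auto simp: markov_triple_def intro: finite_subset)
  have "t_mix_from X T x \<epsilon>' \<le> t_mix X T S \<epsilon>" if x: "x \<in> S" for x
  proof -
    have "t_mix_from X T x \<epsilon>' \<le> t_mix_from X T x \<epsilon>"
      using assms S x by (intro t_mix_from_antimono) auto
    also have "\<dots> \<le> t_mix X T S \<epsilon>" unfolding t_mix_def using S x by (intro Max_ge) auto
    finally show ?thesis .
  qed
  then show ?thesis using S by (simp add: t_mix_def[of X T S \<epsilon>'])
qed

theorem t_mix_window:
  assumes triple: "markov_triple X T S" and curv: "nonneg_curved X T" and sym: "symmetric_support X T"
    and card: "card X \<ge> 2" and \<epsilon>: "0 < \<epsilon>" "\<epsilon> < 1" and \<delta>: "\<delta> > 0"
  shows "t_mix X T S \<epsilon> \<le> (1 + \<delta>) * t_mix X T S (1 - \<epsilon>)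
    + window_const \<epsilon> \<delta> * (t_mls X T * max 1 (ln (ln (chain_degree X T))))"
proof -
  interpret finite_chain X T by (rule finite_chain_if_markov_triple[OF triple])
  let ?w = "t_mls X T * max 1 (ln (ln (chain_degree X T)))"
  have S: "finite S" "S \<noteq> {}" "S \<subseteq> X"
    using triple finite_X by (auto simp: markov_triple_def intro: finite_subset)
  have "t_mix_from X T x \<epsilon> \<le> (1 + \<delta>) * t_mix X T S (1 - \<epsilon>) + window_const \<epsilon> \<delta> * ?w"
    if x: "x \<in> S" for x
  proof -
    have "t_mix_from X T x \<epsilon> \<le> (1 + \<delta>) * t_mix_from X T x (1 - \<epsilon>) + window_const \<epsilon> \<delta> * ?w"
      unfolding window_const_def using S x by (intro t_mix_from_window curv sym card \<epsilon> \<delta>) auto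
    also have "t_mix_from X T x (1 - \<epsilon>) \<le> t_mix X T S (1 - \<epsilon>)"
      unfolding t_mix_def using S x by (intro Max_ge) auto
    finally show ?thesis using \<delta> by simp
  qed
  then show ?thesis using S by (simp add: t_mix_def[of X T S \<epsilon>])
qed

section \<open>Cutoff\<close>

text \<open>
  Divide the window bound by \<open>b\<close>: the second term tends to \<open>0\<close>, and \<open>\<delta>\<close> is arbitrary.
\<close>

lemma cutoff_ratio_tendsto_1:
  fixes a b w :: "nat \<Rightarrow> real"
  assumes window: "\<And>\<delta>. \<delta> > 0 \<Longrightarrow> \<exists>C. \<forall>\<^sub>F n in sequentially. b n \<le> (1 + \<delta>) * a n + C * w n"
    and le: "\<And>n. a n \<le> b n" and w: "\<forall>\<^sub>F n in sequentially. w n > 0"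
    and lim: "filterlim (\<lambda>n. b n / w n) at_top sequentially"
  shows "(\<lambda>n. a n / b n) \<longlonglongrightarrow> 1"
proof (rule order_tendstoI)
  have b: "\<forall>\<^sub>F n in sequentially. b n > 0"
    using filterlim_at_top_dense[THEN iffD1, OF lim, rule_format, of 0] w
    by eventually_elim (simp add: zero_less_divide_iff)
  show "\<forall>\<^sub>F n in sequentially. a n / b n < c" if "c > 1" for c
    using b
  proof eventually_elim
    case (elim n)
    then have "a n / b n \<le> 1" using le[of n] by simp
    then show ?case using that by simp
  qed
  fix c :: real assume c: "c < 1"
  define e where "e = min ((1 - c) / 2) (1 / 2)"
  have e: "0 < e" "e < 1" "c < 1 - e" using c by (auto simp: e_def min_def field_simps)
  \<comment> \<open>With \<open>\<delta> = e / 2\<close> and \<open>C w \<le> (e / 2) b\<close>, the window bound gives \<open>(1 - e / 2) b \<le> (1 + e / 2) a\<close>,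
      and \<open>(1 - e) (1 + e / 2) < 1 - e / 2\<close>.\<close>
  obtain C where C: "\<forall>\<^sub>F n in sequentially. b n \<le> (1 + e / 2) * a n + C * w n"
    using window[of "e / 2"] e by auto
  have "\<forall>\<^sub>F n in sequentially. 2 * C / e < b n / w n"
    using filterlim_at_top_dense[THEN iffD1, OF lim] by blast
  then show "\<forall>\<^sub>F n in sequentially. c < a n / b n"
    using C w b
  proof eventually_elim
    case (elim n)
    have "C * w n < e / 2 * b n" using elim e by (simp add: field_simps)
    then have "(1 - e / 2) * b n < (1 + e / 2) * a n" using elim by (simp add: algebra_simps)
    moreover have "(1 + e / 2) * ((1 - e) * b n) \<le> (1 - e / 2) * b n"
    proof -
      have "(1 + e / 2) * (1 - e) \<le> 1 - e / 2" using e by (simp add: algebra_simps)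
      from mult_right_mono[OF this, of "b n"] elim show ?thesis by (simp add: mult.assoc)
    qed
    ultimately have "(1 + e / 2) * ((1 - e) * b n) < (1 + e / 2) * a n" by simp
    then have "(1 - e) * b n < a n" using e by (simp add: mult_less_cancel_left)
    then have "1 - e < a n / b n" using elim by (simp add: pos_less_divide_eq)
    then show ?case using e by simp
  qed
qed

text \<open>
  The criterion for one \<open>\<epsilon>'\<close> carries over to every smaller value, and the ratio for \<open>\<epsilon>\<close> lies between
  the ratio for a smaller \<open>\<eta>\<close> and its inverse. So it suffices to treat one \<open>\<eta>\<close> below \<open>\<epsilon>\<close>, \<open>1 - \<epsilon>\<close> and
  \<open>\<epsilon>'\<close>, where the window bound applies.
\<close>

theorem theorem1:
  fixes X :: "nat \<Rightarrow> 'a set"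
    and T :: "nat \<Rightarrow> 'a \<Rightarrow> 'a \<Rightarrow> real"
    and S :: "nat \<Rightarrow> 'a set"
  assumes "\<And>n. markov_triple (X n) (T n) (S n)"
    and "\<And>n. nonneg_curved (X n) (T n)"
    and "\<And>n. symmetric_support (X n) (T n)"
    and "\<exists>\<epsilon>\<in>{0<..<1}. filterlim
           (\<lambda>n. t_mix (X n) (T n) (S n) \<epsilon>
                / (t_mls (X n) (T n) * max 1 (ln (ln (chain_degree (X n) (T n))))))
           at_top sequentially"
  shows "\<forall>\<epsilon>\<in>{0<..<1}.
           (\<lambda>n. t_mix (X n) (T n) (S n) (1 - \<epsilon>) / t_mix (X n) (T n) (S n) \<epsilon>)
           \<longlonglongrightarrow> 1"
proof
  fix \<epsilon> :: real assume \<epsilon>: "\<epsilon> \<in> {0<..<1}"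
  define \<tau> where "\<tau> = (\<lambda>e n. t_mix (X n) (T n) (S n) e)"
  define w where "w n = t_mls (X n) (T n) * max 1 (ln (ln (chain_degree (X n) (T n))))" for n
  obtain \<epsilon>' where \<epsilon>': "\<epsilon>' \<in> {0<..<1}" and lim': "filterlim (\<lambda>n. \<tau> \<epsilon>' n / w n) at_top sequentially"
    using assms(4) by (auto simp: \<tau>_def w_def)
  define \<eta> where "\<eta> = Min {\<epsilon>, 1 - \<epsilon>, \<epsilon>'}"
  have \<eta>: "0 < \<eta>" "\<eta> < 1" "\<eta> \<le> \<epsilon>" "\<eta> \<le> 1 - \<epsilon>" "\<eta> \<le> \<epsilon>'"
    using \<epsilon> \<epsilon>' by (auto simp: \<eta>_def)
  have anti: "\<tau> e' n \<le> \<tau> e n" if "0 < e" "e \<le> e'" for e e' n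
    unfolding \<tau>_def by (rule t_mix_antimono[OF assms(1) that])
  have card: "\<forall>\<^sub>F n in sequentially. card (X n) \<ge> 2"
    using filterlim_at_top_dense[THEN iffD1, OF lim', rule_format, of 0]
  proof eventually_elim
    case (elim n)
    then show ?case using t_mix_singleton[OF assms(1), of n \<epsilon>'] \<epsilon>' by (force simp: \<tau>_def)
  qed
  have w: "\<forall>\<^sub>F n in sequentially. w n > 0"
    using card
  proof eventually_elim
    case (elim n)
    interpret finite_chain "X n" "T n" by (rule finite_chain_if_markov_triple[OF assms(1)])
    show ?case unfolding w_def using t_mls_ge[OF elim] by (intro mult_pos_pos) auto
  qed
  have lim: "filterlim (\<lambda>n. \<tau> \<eta> n / w n) at_top sequentially"
    using w by (intro filterlim_at_top_mono[OF lim'])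
      (auto elim!: eventually_mono intro!: divide_right_mono anti \<eta>)
  have "(\<lambda>n. \<tau> (1 - \<eta>) n / \<tau> \<eta> n) \<longlonglongrightarrow> 1"
  proof (rule cutoff_ratio_tendsto_1[OF _ _ w lim])
    show "\<exists>C. \<forall>\<^sub>F n in sequentially. \<tau> \<eta> n \<le> (1 + \<delta>) * \<tau> (1 - \<eta>) n + C * w n" if "\<delta> > 0" for \<delta>
      using card unfolding \<tau>_def w_def
      by (intro exI[of _ "window_const \<eta> \<delta>"])
        (auto elim!: eventually_mono intro!: t_mix_window assms \<eta> that)
    show "\<tau> (1 - \<eta>) n \<le> \<tau> \<eta> n" for n using \<eta> by (intro anti) auto
  qed
  then have low: "(\<lambda>n. \<tau> (1 - \<eta>) n / \<tau> \<eta> n) \<longlonglongrightarrow> 1"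
    and high: "(\<lambda>n. \<tau> \<eta> n / \<tau> (1 - \<eta>) n) \<longlonglongrightarrow> 1"
    using tendsto_inverse[of "\<lambda>n. \<tau> (1 - \<eta>) n / \<tau> \<eta> n" 1] by auto
  have "\<forall>\<^sub>F n in sequentially. \<tau> \<eta> n > 0"
    using filterlim_at_top_dense[THEN iffD1, OF lim, rule_format, of 0] w
    by eventually_elim (simp add: zero_less_divide_iff)
  moreover have "\<forall>\<^sub>F n in sequentially. \<tau> (1 - \<eta>) n / \<tau> \<eta> n > 0"
    using low by (rule order_tendstoD) simp
  ultimately have pos: "\<forall>\<^sub>F n in sequentially. 0 < \<tau> (1 - \<eta>) n \<and> 0 < \<tau> \<eta> n"
    by eventually_elim (simp add: zero_less_divide_iff)
  have between: "\<tau> (1 - \<eta>) n \<le> \<tau> e n" "\<tau> e n \<le> \<tau> \<eta> n" if "\<eta> \<le> e" "e \<le> 1 - \<eta>" for e n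
    using that \<eta> by (auto intro!: anti)
  have "(\<lambda>n. \<tau> (1 - \<epsilon>) n / \<tau> \<epsilon> n) \<longlonglongrightarrow> 1"
  proof (rule tendsto_sandwich[OF _ _ low high])
    show "\<forall>\<^sub>F n in sequentially. \<tau> (1 - \<eta>) n / \<tau> \<eta> n \<le> \<tau> (1 - \<epsilon>) n / \<tau> \<epsilon> n"
      using pos
    proof eventually_elim
      case (elim n)
      then show ?case using between[of \<epsilon> n] between[of "1 - \<epsilon>" n] \<eta> by (intro frac_le) auto
    qed
    show "\<forall>\<^sub>F n in sequentially. \<tau> (1 - \<epsilon>) n / \<tau> \<epsilon> n \<le> \<tau> \<eta> n / \<tau> (1 - \<eta>) n"
      using pos
    proof eventually_elim
      case (elim n)
      then show ?case using between[of \<epsilon> n] between[of "1 - \<epsilon>" n] \<eta> by (intro frac_le) auto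
    qed
  qed
  then show "(\<lambda>n. t_mix (X n) (T n) (S n) (1 - \<epsilon>) / t_mix (X n) (T n) (S n) \<epsilon>) \<longlonglongrightarrow> 1"
    by (simp add: \<tau>_def)
qed

end
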